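(* Let $\lambda^+,\lambda^->0$, and let $\{(x_j^+,y_j^+)\}_{j\in\mathbb{N}}$ and $\{(x_j^-,y_j^-)\}_{j\in\mathbb{N}}$ be the random points of two independent (homogeneous) Poisson point processes on $\mathbb{R}^2$ with intensity parameters $\lambda^+$ and $\lambda^-$ respectively, defined on a probability space $(\Omega,\mathcal{F},\mathbb{P})$. Let $\alpha>\sqrt{2}$ and let $\varphi\in C_c^\infty(\mathbb{R}^2)$ be a non-negative function with $\varphi\ge 1$ on $[-1,1]^2$ and $\varphi=0$ on $\mathbb{R}^2\setminus B_\alpha(0)$. Let $k\in(0,1]$. For every $\rho>0$ define $$f_\rho(x,y,\omega):=\sum_{j}\frac{2k}{\rho}\,\varphi\left(\frac{x-x_j^+(\omega)}{\rho},\frac{y-y_j^+(\omega)}{\rho}\right).$$ Then there exist (deterministic) $\rho^*>0$ and $F^*>0$ such that, almost surely, there exists a function $v:\mathbb{R}\to(0,\infty)$ (depending on $\omega$) that satisfies $$v''(x)-f_{\rho^*}(x,v(x),\omega)+F^*\le 0,\qquad x\in\mathbb{R},$$ in the viscosity sense, and $$\mathrm{dist}\big((x,v(x)),(x_j^-(\omega),y_j^-(\omega))\big)>\alpha\rho^*\quad\text{for all } x\in\mathbb{R}\text{ and all } j\in\mathbb{N}.$$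
   Context: $B_\alpha(0)$ is the Euclidean ball of radius $\alpha$ centred at the origin of $\mathbb{R}^2$, and $\mathrm{dist}$ is the Euclidean distance in $\mathbb{R}^2$. $C_c^\infty(\mathbb{R}^2)$ is the space of smooth compactly supported real functions. "In the viscosity sense" has the standard meaning of viscosity supersolution: for a continuous function $g:\mathbb{R}^2\to\mathbb{R}$ and $F\in\mathbb{R}$, a lower semicontinuous function $v:\mathbb{R}\to\mathbb{R}$ satisfies $v''-g(x,v(x))+F\le 0$ in the viscosity sense if for every $x_0\in\mathbb{R}$ and every $C^2$ function $\psi$ defined near $x_0$ such that $v-\psi$ has a local minimum at $x_0$, one has $\psi''(x_0)-g(x_0,v(x_0))+F\le 0$. *)

theory Defs
  imports "HOL-Probability.Probability"
begin

text \<open>\<open>Ck_on k S f\<close> is meant for open \<open>S\<close>: all directional derivatives of \<open>f\<close> of order at most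
  \<open>k\<close> exist on \<open>S\<close> as Frechet derivatives and are continuous there.\<close>

primrec Ck_on :: "nat \<Rightarrow> 'a::euclidean_space set \<Rightarrow> ('a \<Rightarrow> 'b::real_normed_vector) \<Rightarrow> bool" where
  "Ck_on 0 S f \<longleftrightarrow> continuous_on S f"
| "Ck_on (Suc k) S f \<longleftrightarrow>
     (\<forall>x\<in>S. f differentiable (at x)) \<and> (\<forall>h. Ck_on k S (\<lambda>x. frechet_derivative f (at x) h))"

definition smooth_compact_support :: "('a::euclidean_space \<Rightarrow> 'b::real_normed_vector) \<Rightarrow> bool" where
  "smooth_compact_support f \<longleftrightarrow> (\<forall>k. Ck_on k UNIV f) \<and> compact (closure {x. f x \<noteq> 0})"

definition lower_semicontinuous :: "('a::topological_space \<Rightarrow> real) \<Rightarrow> bool" where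
  "lower_semicontinuous v \<longleftrightarrow> (\<forall>x. \<forall>c < v x. eventually (\<lambda>y. c < v y) (nhds x))"

text \<open>\<open>v'' - g (x, v x) + F \<le> 0\<close> on the real line in the viscosity sense; the test function
  \<open>\<psi>\<close> is only required to be \<open>C\<^sup>2\<close> on some open neighbourhood \<open>U\<close> of \<open>x\<^sub>0\<close>.
  The notion is meant for continuous \<open>g\<close>.\<close>

definition viscosity_supersolution ::
    "(real \<times> real \<Rightarrow> real) \<Rightarrow> real \<Rightarrow> (real \<Rightarrow> real) \<Rightarrow> bool" where
  "viscosity_supersolution g F v \<longleftrightarrow>
     lower_semicontinuous v \<and>
     (\<forall>x\<^sub>0 U \<psi>. open U \<longrightarrow> x\<^sub>0 \<in> U \<longrightarrow> Ck_on 2 U \<psi> \<longrightarrow>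
        eventually (\<lambda>x. v x\<^sub>0 - \<psi> x\<^sub>0 \<le> v x - \<psi> x) (nhds x\<^sub>0) \<longrightarrow>
        deriv (deriv \<psi>) x\<^sub>0 - g (x\<^sub>0, v x\<^sub>0) + F \<le> 0)"

text \<open>A point process is given by an enumeration \<open>X\<close> of its random points; \<open>point_count X A \<omega>\<close>
  is the (possibly infinite) number of points in \<open>A\<close>.\<close>

definition point_count :: "(nat \<Rightarrow> 'w \<Rightarrow> 'a) \<Rightarrow> 'a set \<Rightarrow> 'w \<Rightarrow> ennreal" where
  "point_count X A \<omega> = emeasure (count_space UNIV) {j. X j \<omega> \<in> A}"

text \<open>The Poisson weights are written out, since the library's \<open>poisson_pmf\<close> is specified only for
  positive rates, whereas \<open>A\<close> may be a null set.\<close>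

definition poisson_point_process ::
    "'w measure \<Rightarrow> real \<Rightarrow> (nat \<Rightarrow> 'w \<Rightarrow> 'a::euclidean_space) \<Rightarrow> bool" where
  "poisson_point_process M l X \<longleftrightarrow>
     (\<forall>j. X j \<in> borel_measurable M) \<and>
     (\<forall>A n. A \<in> sets borel \<longrightarrow> bounded A \<longrightarrow>
        measure M {\<omega> \<in> space M. point_count X A \<omega> = of_nat n} =
          (l * measure lborel A) ^ n / fact n * exp (- (l * measure lborel A))) \<and>
     (\<forall>A :: nat \<Rightarrow> 'a set. (\<forall>i. A i \<in> sets borel \<and> bounded (A i)) \<longrightarrow> disjoint_family A \<longrightarrow>
        prob_space.indep_vars M (\<lambda>_. borel) (\<lambda>i. point_count X (A i)) UNIV)"

text \<open>Independence of the two random counting measures; the enumerations of the points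
  themselves need not be independent.\<close>

definition independent_point_processes ::
    "'w measure \<Rightarrow> (nat \<Rightarrow> 'w \<Rightarrow> 'a::euclidean_space) \<Rightarrow> (nat \<Rightarrow> 'w \<Rightarrow> 'a) \<Rightarrow> bool" where
  "independent_point_processes M X Y \<longleftrightarrow>
     prob_space.indep_var M
       (PiM (sets borel) (\<lambda>_. borel)) (\<lambda>\<omega>. \<lambda>A\<in>sets borel. point_count X A \<omega>)
       (PiM (sets borel) (\<lambda>_. borel)) (\<lambda>\<omega>. \<lambda>A\<in>sets borel. point_count Y A \<omega>)"

definition obstacle_force ::
    "real \<Rightarrow> (real \<times> real \<Rightarrow> real) \<Rightarrow> (nat \<Rightarrow> 'w \<Rightarrow> real \<times> real) \<Rightarrow> real \<Rightarrow> 'w \<Rightarrow> real \<times> real \<Rightarrow> real"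
  where
  "obstacle_force k \<phi> X \<rho> \<omega> = (\<lambda>(x, y).
     \<Sum>j. 2 * k / \<rho> * \<phi> ((x - fst (X j \<omega>)) / \<rho>, (y - snd (X j \<omega>)) / \<rho>))"

end

theory Submission
  imports Defs "HOL-Library.Transitive_Closure_Table"
begin

text \<open>A single positive obstacle at \<open>(a, b)\<close> supports a V-shaped barrier: a parabola of curvature
  \<open>k / \<rho>\<close> inside the obstacle, which gains slope of order \<open>k\<close> independently of \<open>\<rho>\<close>, continued on both
  sides by parabolas of curvature \<open>- F\<close>. A minimum of such barriers is again a supersolution, so it
  suffices to select in every column of width \<open>d\<close> one obstacle, in such a way that the heights of
  neighbouring columns differ by less than what the barriers climb over a column.

  Such a selection is a Lipschitz percolation problem for boxes of size \<open>d \<times> h\<close> with \<open>h\<close> much smaller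
  than \<open>k d\<close>. A box is open if it contains a positive obstacle whose whole barrier stays away from
  the negative points; this condition involves the box and a bounded neighbourhood only. For large
  boxes a positive obstacle exists with high probability, and then, as \<open>\<rho> \<rightarrow> 0\<close>, the \<open>\<rho>\<close>-neighbourhood
  of its barrier has vanishing area and hence contains no negative point with high probability.
  The surface runs just above all boxes that can be reached from height \<open>0\<close> by moving
  up into closed boxes or diagonally down; a Peierls estimate shows that the reachable heights are
  almost surely finite in every column.\<close>

section \<open>Poisson point processes\<close>

text \<open>The percolation argument asks of a process only whether a region contains a point, so
  the counts enter it through this predicate alone.\<close>

definition hits :: "(nat \<Rightarrow> 'w \<Rightarrow> 'a) \<Rightarrow> 'a set \<Rightarrow> 'w \<Rightarrow> bool" where
  "hits X A \<omega> \<longleftrightarrow> (\<exists>j. X j \<omega> \<in> A)"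

lemma point_count_eq_0_iff: "point_count X A \<omega> = 0 \<longleftrightarrow> \<not> hits X A \<omega>"
  by (auto simp: point_count_def hits_def emeasure_count_space_eq_0)

context prob_space
begin

lemma hits_event:
  fixes X :: "nat \<Rightarrow> 'a \<Rightarrow> 'b::euclidean_space"
  assumes "poisson_point_process M l X" "A \<in> sets borel"
  shows "{\<omega> \<in> space M. hits X A \<omega>} \<in> events"
proof -
  have "{\<omega> \<in> space M. hits X A \<omega>} = (\<Union>j. X j -` A \<inter> space M)"
    by (auto simp: hits_def)
  moreover have "X j -` A \<inter> space M \<in> events" for j
    using assms by (auto simp: poisson_point_process_def intro: measurable_sets)
  then have "(\<Union>j. X j -` A \<inter> space M) \<in> events" by (intro sets.countable_UN) auto
  ultimately show ?thesis by simp
qed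

lemma hits_eq_event:
  fixes X :: "nat \<Rightarrow> 'a \<Rightarrow> 'b::euclidean_space"
  assumes "poisson_point_process M l X" "A \<in> sets borel"
  shows "{\<omega> \<in> space M. hits X A \<omega> = b} \<in> events"
  using hits_event[OF assms] sets.sets_Collect_neg[OF hits_event[OF assms]] by (cases b) auto

lemma prob_not_hits:
  fixes X :: "nat \<Rightarrow> 'a \<Rightarrow> 'b::euclidean_space"
  assumes "poisson_point_process M l X" "A \<in> sets borel" "bounded A"
  shows "prob {\<omega> \<in> space M. \<not> hits X A \<omega>} = exp (- (l * measure lborel A))"
proof -
  have "prob {\<omega> \<in> space M. point_count X A \<omega> = of_nat 0} =
      (l * measure lborel A) ^ 0 / fact 0 * exp (- (l * measure lborel A))"
    using assms unfolding poisson_point_process_def by blast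
  then show ?thesis by (simp add: point_count_eq_0_iff)
qed

text \<open>By \<open>1 - exp (- x) \<le> x\<close>. A bound linear in the area is what makes thin
  tubes harmless.\<close>

lemma prob_hits_le:
  fixes X :: "nat \<Rightarrow> 'a \<Rightarrow> 'b::euclidean_space"
  assumes "poisson_point_process M l X" "A \<in> sets borel" "bounded A"
  shows "prob {\<omega> \<in> space M. hits X A \<omega>} \<le> l * measure lborel A"
proof -
  have "prob {\<omega> \<in> space M. \<not> hits X A \<omega>} = 1 - prob {\<omega> \<in> space M. hits X A \<omega>}"
    by (rule prob_neg) (rule hits_event[OF assms(1,2)])
  then show ?thesis
    using prob_not_hits[OF assms] exp_ge_add_one_self[of "- (l * measure lborel A)"] by simp
qed

text \<open>Independence of counts is assumed for sequences of sets indexed by all naturals, so the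
  finite family is enumerated and continued by empty sets.\<close>

lemma prob_hits_pattern:
  fixes X :: "nat \<Rightarrow> 'a \<Rightarrow> 'b::euclidean_space"
  assumes X: "poisson_point_process M l X" and S: "finite S"
    and D: "\<And>s. s \<in> S \<Longrightarrow> D s \<in> sets borel" "\<And>s. s \<in> S \<Longrightarrow> bounded (D s)" "disjoint_family_on D S"
  shows "prob {\<omega> \<in> space M. \<forall>s\<in>S. hits X (D s) \<omega> = B s} =
    (\<Prod>s\<in>S. prob {\<omega> \<in> space M. hits X (D s) \<omega> = B s})"
proof (cases "S = {}")
  case False
  obtain e where e: "bij_betw e {0..<card S} S"
    using ex_bij_betw_nat_finite[OF S] by blast
  let ?J = "{0..<card S}"
  define A where "A i = (if i < card S then D (e i) else {})" for i
  define F where "F i = {\<omega> \<in> space M. (point_count X (A i) \<omega> \<noteq> 0) = B (e i)}" for i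
  have e_in: "e i \<in> S" if "i < card S" for i
    using e that by (auto simp: bij_betw_def)
  have "A i \<in> sets borel \<and> bounded (A i)" for i
    using D(1,2) e_in by (auto simp: A_def)
  moreover have "disjoint_family A"
    unfolding disjoint_family_on_def
  proof (intro ballI impI)
    fix i j :: nat assume "i \<noteq> j"
    show "A i \<inter> A j = {}"
    proof (cases "i < card S \<and> j < card S")
      case True
      then have "e i \<noteq> e j"
        using \<open>i \<noteq> j\<close> e by (auto simp: bij_betw_def inj_on_def)
      then show ?thesis
        using D(3) True e_in by (auto simp: A_def disjoint_family_on_def)
    qed (auto simp: A_def)
  qed
  ultimately have "indep_vars (\<lambda>_. borel) (\<lambda>i. point_count X (A i)) UNIV"
    using X unfolding poisson_point_process_def by blast
  then have "indep_events F UNIV"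
    unfolding F_def by (rule indep_eventsI_indep_vars) simp
  moreover have "?J \<noteq> {}"
    using False S by auto
  ultimately have "prob (\<Inter>i\<in>?J. F i) = (\<Prod>i\<in>?J. prob (F i))"
    unfolding indep_events_def by blast
  moreover have F: "F i = {\<omega> \<in> space M. hits X (D (e i)) \<omega> = B (e i)}" if "i \<in> ?J" for i
    using that by (simp add: F_def A_def point_count_eq_0_iff)
  have "(\<Inter>i\<in>?J. F i) = (\<Inter>i\<in>?J. {\<omega> \<in> space M. hits X (D (e i)) \<omega> = B (e i)})"
    using F by (intro INF_cong) auto
  also have "\<dots> = {\<omega> \<in> space M. \<forall>s\<in>e ` ?J. hits X (D s) \<omega> = B s}"
    using \<open>?J \<noteq> {}\<close> by auto
  also have "e ` ?J = S"
    using e by (simp add: bij_betw_def)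
  moreover have "(\<Prod>i\<in>?J. prob (F i)) = (\<Prod>s\<in>S. prob {\<omega> \<in> space M. hits X (D s) \<omega> = B s})"
    using F by (subst prod.reindex_bij_betw[OF e, symmetric]) (intro prod.cong, auto)
  ultimately show ?thesis by simp
qed (simp add: prob_space)

text \<open>A condition on finitely many counts is a measurable set of the product space in which
  independence of the two counting measures is expressed.\<close>

lemma prob_hits_pattern_two_processes:
  fixes X Y :: "nat \<Rightarrow> 'a \<Rightarrow> 'b::euclidean_space"
  assumes ind: "independent_point_processes M X Y" and S: "finite S" "finite T"
    and D: "\<And>s. s \<in> S \<Longrightarrow> D s \<in> sets borel" "\<And>t. t \<in> T \<Longrightarrow> E t \<in> sets borel"
  shows "prob {\<omega> \<in> space M. (\<forall>s\<in>S. hits X (D s) \<omega> = B s) \<and> (\<forall>t\<in>T. hits Y (E t) \<omega> = C t)} =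
    prob {\<omega> \<in> space M. \<forall>s\<in>S. hits X (D s) \<omega> = B s} * prob {\<omega> \<in> space M. \<forall>t\<in>T. hits Y (E t) \<omega> = C t}"
proof -
  let ?P = "PiM (sets borel) (\<lambda>_. borel) :: ('b set \<Rightarrow> ennreal) measure"
  define cX where "cX = (\<lambda>\<omega>. \<lambda>A\<in>sets borel. point_count X A \<omega>)"
  define cY where "cY = (\<lambda>\<omega>. \<lambda>A\<in>sets borel. point_count Y A \<omega>)"
  have pattern_set: "{f \<in> space ?P. \<forall>i\<in>I. (f (G i) \<noteq> 0) = K i} \<in> sets ?P"
    if "finite I" "\<And>i. i \<in> I \<Longrightarrow> G i \<in> sets borel" for I :: "'i set" and G K
  proof (rule sets.sets_Collect_finite_All[OF _ that(1)])
    fix i assume "i \<in> I"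
    then have [measurable]: "(\<lambda>f. f (G i)) \<in> borel_measurable ?P"
      using that(2) by (intro measurable_component_singleton)
    show "{f \<in> space ?P. (f (G i) \<noteq> 0) = K i} \<in> sets ?P" by measurable
  qed
  have indep: "indep_var ?P cX ?P cY"
    using ind by (simp add: independent_point_processes_def cX_def cY_def)
  define SX where "SX = {f \<in> space ?P. \<forall>s\<in>S. (f (D s) \<noteq> 0) = B s}"
  define SY where "SY = {f \<in> space ?P. \<forall>t\<in>T. (f (E t) \<noteq> 0) = C t}"
  have sets: "SX \<in> sets ?P" "SY \<in> sets ?P"
    unfolding SX_def SY_def by (intro pattern_set S D; assumption)+
  have "indep_set (sigma_sets (space M) {cX -` A \<inter> space M | A. A \<in> sets ?P})
      (sigma_sets (space M) {cY -` A \<inter> space M | A. A \<in> sets ?P})"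
    using indep unfolding indep_var_eq by blast
  moreover have "cX -` SX \<inter> space M \<in> sigma_sets (space M) {cX -` A \<inter> space M | A. A \<in> sets ?P}"
    "cY -` SY \<inter> space M \<in> sigma_sets (space M) {cY -` A \<inter> space M | A. A \<in> sets ?P}"
    using sets by (auto intro: sigma_sets.Basic)
  ultimately have "prob ((cX -` SX \<inter> space M) \<inter> (cY -` SY \<inter> space M)) =
      prob (cX -` SX \<inter> space M) * prob (cY -` SY \<inter> space M)"
    unfolding indep_sets2_eq by blast
  moreover have eqs: "cX -` SX \<inter> space M = {\<omega> \<in> space M. \<forall>s\<in>S. hits X (D s) \<omega> = B s}"
    "cY -` SY \<inter> space M = {\<omega> \<in> space M. \<forall>t\<in>T. hits Y (E t) \<omega> = C t}"
    using D by (auto simp: SX_def SY_def cX_def cY_def point_count_eq_0_iff space_PiM)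
  moreover have "(cX -` SX \<inter> space M) \<inter> (cY -` SY \<inter> space M) =
      {\<omega> \<in> space M. (\<forall>s\<in>S. hits X (D s) \<omega> = B s) \<and> (\<forall>t\<in>T. hits Y (E t) \<omega> = C t)}"
    unfolding eqs by auto
  ultimately show ?thesis by simp
qed

text \<open>The Poisson weights of a ball sum to one, so its count is almost surely a natural
  number; countably many balls serve all bounded sets with a single null set.\<close>

lemma AE_finite_points:
  fixes X :: "nat \<Rightarrow> 'a \<Rightarrow> 'b::euclidean_space"
  assumes X: "poisson_point_process M l X"
  shows "AE \<omega> in M. \<forall>A. bounded A \<longrightarrow> finite {j. X j \<omega> \<in> A}"
proof -
  have "AE \<omega> in M. finite {j. X j \<omega> \<in> cball 0 (real m)}" for m :: nat
  proof -
    let ?A = "cball 0 (real m) :: 'b set"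
    define c where "c = l * measure lborel ?A"
    define F where "F n = {\<omega> \<in> space M. point_count X ?A \<omega> = of_nat n}" for n :: nat
    \<comment> \<open>Measurability of a single count is read off from the independence of a family
      with the ball at index 0 and empty sets elsewhere.\<close>
    have "(\<lambda>\<omega>. point_count X (if i = (0::nat) then ?A else {}) \<omega>) \<in> borel_measurable M" for i
    proof -
      have "indep_vars (\<lambda>_. borel) (\<lambda>i. point_count X (if i = (0::nat) then ?A else {})) UNIV"
        using X unfolding poisson_point_process_def
        by (elim conjE allE[of _ "\<lambda>i. if i = (0::nat) then ?A else {}"]) (auto simp: disjoint_family_on_def)
      then show ?thesis unfolding indep_vars_def by blast
    qed
    from this[of 0] have meas: "point_count X ?A \<in> borel_measurable M" by simp
    have F: "F n \<in> events" for n
      unfolding F_def using meas by measurable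
    have "prob (F n) = c ^ n / fact n * exp (- c)" for n
      using X unfolding poisson_point_process_def F_def c_def by auto
    moreover have "(\<lambda>n. c ^ n / fact n * exp (- c)) sums (exp c * exp (- c))"
      using exp_converges[of c] by (intro sums_mult2) (simp add: divide_inverse scaleR_conv_of_real mult.commute)
    ultimately have "(\<lambda>n. prob (F n)) sums 1" by (simp flip: exp_add)
    moreover have "(\<lambda>n. prob (F n)) sums prob (\<Union>n. F n)"
      using F by (intro finite_measure_UNION) (auto simp: disjoint_family_on_def F_def)
    ultimately have "prob (\<Union>n. F n) = 1" by (rule sums_unique2[symmetric])
    then have "AE \<omega> in M. \<omega> \<in> (\<Union>n. F n)" by (rule prob_eq_1[THEN iffD1, rotated]) (use F in auto)
    then show ?thesis
    proof (rule AE_mp, intro AE_I2 impI)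
      fix \<omega> assume "\<omega> \<in> (\<Union>n. F n)"
      then have "point_count X ?A \<omega> \<noteq> \<infinity>" by (auto simp: F_def)
      then show "finite {j. X j \<omega> \<in> ?A}"
        unfolding point_count_def by (auto simp: emeasure_count_space split: if_splits)
    qed
  qed
  then have "AE \<omega> in M. \<forall>m::nat. finite {j. X j \<omega> \<in> cball 0 (real m)}"
    by (simp add: AE_all_countable)
  then show ?thesis
  proof (rule AE_mp, intro AE_I2 impI allI)
    fix \<omega> and A :: "'b set"
    assume fin: "\<forall>m::nat. finite {j. X j \<omega> \<in> cball 0 (real m)}" and "bounded A"
    then obtain r where "\<And>x. x \<in> A \<Longrightarrow> norm x \<le> r" by (auto simp: bounded_iff)
    moreover obtain m :: nat where "r \<le> real m" using real_arch_simple by blast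
    ultimately have "{j. X j \<omega> \<in> A} \<subseteq> {j. X j \<omega> \<in> cball 0 (real m)}" by fastforce
    then show "finite {j. X j \<omega> \<in> A}" using fin finite_subset by blast
  qed
qed

end

text \<open>Union bound over the reasons why each site is blocked: its box is empty (\<open>None\<close>), or a certain
  cell is occupied and a certain piece of its tube is hit (\<open>Some\<close>). For a fixed choice of reasons the
  events factorise.\<close>

lemma (in prob_space) prob_all_blocked_le:
  fixes X Y :: "nat \<Rightarrow> 'a \<Rightarrow> 'b::euclidean_space"
    and box :: "'s \<Rightarrow> 'b set" and cell :: "'s \<Rightarrow> 'c \<Rightarrow> 'b set" and tube :: "'s \<Rightarrow> 'c \<Rightarrow> 'm \<Rightarrow> 'b set"
  assumes X: "poisson_point_process M lp X" and Y: "poisson_point_process M lm Y"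
    and ind: "independent_point_processes M X Y" and l: "0 \<le> lp" "0 \<le> lm"
    and fin: "finite S" "finite I" "finite J"
    and borel: "\<And>z. box z \<in> sets borel" "\<And>z c. cell z c \<in> sets borel" "\<And>z c m. tube z c m \<in> sets borel"
    and bounded: "\<And>z. bounded (box z)" "\<And>z c. bounded (cell z c)" "\<And>z c m. bounded (tube z c m)"
    and cover: "\<And>z. box z \<subseteq> (\<Union>c\<in>I. cell z c)" and cell_box: "\<And>z c. c \<in> I \<Longrightarrow> cell z c \<subseteq> box z"
    and disj: "disjoint_family_on box S"
    and tube_disj: "\<And>z w c c' m m'. z \<in> S \<Longrightarrow> w \<in> S \<Longrightarrow> z \<noteq> w \<Longrightarrow> c \<in> I \<Longrightarrow> c' \<in> I \<Longrightarrow> m \<in> J \<Longrightarrow> m' \<in> J \<Longrightarrow>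
      tube z c m \<inter> tube w c' m' = {}"
    and area: "\<And>z. measure lborel (box z) = area_box" "\<And>z c. measure lborel (cell z c) = area_cell"
      "\<And>z c m. measure lborel (tube z c m) = area_tube"
  shows "prob {\<omega> \<in> space M. \<forall>z\<in>S. \<forall>c\<in>I. hits X (cell z c) \<omega> \<longrightarrow> (\<exists>m\<in>J. hits Y (tube z c m) \<omega>)}
    \<le> (exp (- (lp * area_box)) + real (card I * card J) * ((lp * area_cell) * (lm * area_tube))) ^ card S"
proof -
  \<comment> \<open>The possible reasons at one site; \<open>wX\<close> and \<open>wY\<close> bound
    what each process contributes. An empty box asks nothing of the negative process, hence the
    factor 1, which extends the product over \<open>T g\<close> to all of \<open>S\<close>.\<close>
  define W where "W = insert None (Some ` (I \<times> J))"
  define wX where "wX wit = (case wit of None \<Rightarrow> exp (- (lp * area_box)) | Some _ \<Rightarrow> lp * area_cell)"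
    for wit :: "('c \<times> 'm) option"
  define wY where "wY wit = (case wit of None \<Rightarrow> 1 | Some _ \<Rightarrow> lm * area_tube)" for wit :: "('c \<times> 'm) option"
  define DX where "DX g z = (case g z of None \<Rightarrow> box z | Some (c, m) \<Rightarrow> cell z c)"
    for g :: "'s \<Rightarrow> ('c \<times> 'm) option" and z
  define DY where "DY g z = (case g z of None \<Rightarrow> {} | Some (c, m) \<Rightarrow> tube z c m)"
    for g :: "'s \<Rightarrow> ('c \<times> 'm) option" and z
  define T where "T g = {z \<in> S. g z \<noteq> None}" for g :: "'s \<Rightarrow> ('c \<times> 'm) option"
  \<comment> \<open>Comparing with \<open>g z \<noteq> None\<close> lets a single pattern ask for
    empty boxes and for occupied cells.\<close>
  define G where "G g = {\<omega> \<in> space M. (\<forall>z\<in>S. hits X (DX g z) \<omega> = (g z \<noteq> None)) \<and> (\<forall>z\<in>T g. hits Y (DY g z) \<omega> = True)}"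
    for g :: "'s \<Rightarrow> ('c \<times> 'm) option"
  have W: "finite W" using fin by (simp add: W_def)
  have D: "DX g z \<in> sets borel" "bounded (DX g z)" "DY g z \<in> sets borel" "bounded (DY g z)" for g z
    using borel bounded by (auto simp: DX_def DY_def split: option.split)
  have finT: "finite (T g)" for g using fin by (simp add: T_def)
  have area_nonneg: "0 \<le> area_cell" "0 \<le> area_tube"
    using area(2,3) measure_nonneg by metis+
  have G_event: "G g \<in> events" for g
  proof -
    have "{\<omega> \<in> space M. \<forall>z\<in>S. hits X (DX g z) \<omega> = (g z \<noteq> None)} \<in> events"
      using hits_eq_event[OF X] D fin by (intro sets.sets_Collect_finite_All) auto
    moreover have "{\<omega> \<in> space M. \<forall>z\<in>T g. hits Y (DY g z) \<omega> = True} \<in> events"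
      by (intro sets.sets_Collect_finite_All finT) (rule hits_eq_event[OF Y D(3)])
    moreover have "G g = {\<omega> \<in> space M. \<forall>z\<in>S. hits X (DX g z) \<omega> = (g z \<noteq> None)} \<inter>
        {\<omega> \<in> space M. \<forall>z\<in>T g. hits Y (DY g z) \<omega> = True}"
      by (auto simp: G_def)
    ultimately show ?thesis by simp
  qed
  have G_le: "prob (G g) \<le> (\<Prod>z\<in>S. wX (g z) * wY (g z))" if g: "g \<in> PiE S (\<lambda>_. W)" for g
  proof -
    have gW: "g z = None \<or> (\<exists>c\<in>I. \<exists>m\<in>J. g z = Some (c, m))" if "z \<in> S" for z
      using g that by (auto simp: W_def PiE_iff)
    have "disjoint_family_on (DX g) S"
      unfolding disjoint_family_on_def
    proof (intro ballI impI)
      fix z w assume zw: "z \<in> S" "w \<in> S" "z \<noteq> w"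
      have "DX g z \<subseteq> box z" if "z \<in> S" for z
        using gW[OF that] cell_box by (fastforce simp: DX_def)
      with zw have "DX g z \<subseteq> box z" "DX g w \<subseteq> box w" by auto
      then show "DX g z \<inter> DX g w = {}"
        using disj zw by (fastforce simp: disjoint_family_on_def)
    qed
    then have "prob {\<omega> \<in> space M. \<forall>z\<in>S. hits X (DX g z) \<omega> = (g z \<noteq> None)} =
        (\<Prod>z\<in>S. prob {\<omega> \<in> space M. hits X (DX g z) \<omega> = (g z \<noteq> None)})"
      using D fin by (intro prob_hits_pattern[OF X]) auto
    also have "\<dots> \<le> (\<Prod>z\<in>S. wX (g z))"
    proof (intro prod_mono conjI)
      fix z assume "z \<in> S"
      show "prob {\<omega> \<in> space M. hits X (DX g z) \<omega> = (g z \<noteq> None)} \<le> wX (g z)"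
      proof (cases "g z")
        case None
        then show ?thesis
          using prob_not_hits[OF X borel(1) bounded(1), of z] area(1)[of z] by (simp add: DX_def wX_def)
      next
        case (Some p)
        obtain c m where "p = (c, m)" by (cases p)
        with Some show ?thesis
          using prob_hits_le[OF X borel(2) bounded(2), of z c] area(2)[of z c]
          by (simp add: DX_def wX_def)
      qed
    qed simp
    finally have PX: "prob {\<omega> \<in> space M. \<forall>z\<in>S. hits X (DX g z) \<omega> = (g z \<noteq> None)} \<le> (\<Prod>z\<in>S. wX (g z))" .
    have "disjoint_family_on (DY g) (T g)"
      unfolding disjoint_family_on_def
    proof (intro ballI impI)
      fix z w assume zw: "z \<in> T g" "w \<in> T g" "z \<noteq> w"
      then obtain c m c' m' where "g z = Some (c, m)" "g w = Some (c', m')" "c \<in> I" "m \<in> J" "c' \<in> I" "m' \<in> J"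
        using gW[of z] gW[of w] by (auto simp: T_def)
      then show "DY g z \<inter> DY g w = {}"
        using tube_disj[of z w c c' m m'] zw by (simp add: DY_def T_def)
    qed
    then have "prob {\<omega> \<in> space M. \<forall>z\<in>T g. hits Y (DY g z) \<omega> = True} =
        (\<Prod>z\<in>T g. prob {\<omega> \<in> space M. hits Y (DY g z) \<omega> = True})"
      using D finT by (intro prob_hits_pattern[OF Y]) auto
    also have "\<dots> \<le> (\<Prod>z\<in>T g. wY (g z))"
    proof (intro prod_mono conjI)
      fix z assume "z \<in> T g"
      then obtain c m where "g z = Some (c, m)" by (auto simp: T_def)
      then show "prob {\<omega> \<in> space M. hits Y (DY g z) \<omega> = True} \<le> wY (g z)"
        using prob_hits_le[OF Y borel(3) bounded(3), of z c m] area(3)[of z c m]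
        by (simp add: DY_def wY_def)
    qed simp
    also have "\<dots> = (\<Prod>z\<in>S. wY (g z))"
      using fin(1) by (intro prod.mono_neutral_left) (auto simp: T_def wY_def split: option.splits)
    finally have PY: "prob {\<omega> \<in> space M. \<forall>z\<in>T g. hits Y (DY g z) \<omega> = True} \<le> (\<Prod>z\<in>S. wY (g z))" .
    have "prob (G g) = prob {\<omega> \<in> space M. \<forall>z\<in>S. hits X (DX g z) \<omega> = (g z \<noteq> None)} *
        prob {\<omega> \<in> space M. \<forall>z\<in>T g. hits Y (DY g z) \<omega> = True}"
      unfolding G_def by (rule prob_hits_pattern_two_processes[OF ind fin(1) finT D(1) D(3)])
    also have "\<dots> \<le> (\<Prod>z\<in>S. wX (g z)) * (\<Prod>z\<in>S. wY (g z))"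
      by (intro mult_mono PX PY prod_nonneg) (use l area_nonneg in \<open>auto simp: wX_def split: option.split\<close>)
    finally show ?thesis by (simp add: prod.distrib)
  qed
  have "{\<omega> \<in> space M. \<forall>z\<in>S. \<forall>c\<in>I. hits X (cell z c) \<omega> \<longrightarrow> (\<exists>m\<in>J. hits Y (tube z c m) \<omega>)}
      \<subseteq> (\<Union>g\<in>PiE S (\<lambda>_. W). G g)"
  proof
    fix \<omega> assume \<omega>: "\<omega> \<in> {\<omega> \<in> space M. \<forall>z\<in>S. \<forall>c\<in>I. hits X (cell z c) \<omega> \<longrightarrow> (\<exists>m\<in>J. hits Y (tube z c m) \<omega>)}"
    have "\<exists>wit\<in>W. case wit of None \<Rightarrow> \<not> hits X (box z) \<omega> | Some (c, m) \<Rightarrow> hits X (cell z c) \<omega> \<and> hits Y (tube z c m) \<omega>"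
      if "z \<in> S" for z
    proof (cases "hits X (box z) \<omega>")
      case True
      then obtain c where "c \<in> I" "hits X (cell z c) \<omega>"
        using cover[of z] unfolding hits_def by blast
      moreover from this obtain m where "m \<in> J" "hits Y (tube z c m) \<omega>"
        using \<omega> \<open>z \<in> S\<close> by auto
      ultimately show ?thesis by (intro bexI[of _ "Some (c, m)"]) (auto simp: W_def)
    qed (auto simp: W_def)
    then have "\<forall>z\<in>S. \<exists>wit. wit \<in> W \<and> (case wit of None \<Rightarrow> \<not> hits X (box z) \<omega>
        | Some (c, m) \<Rightarrow> hits X (cell z c) \<omega> \<and> hits Y (tube z c m) \<omega>)"
      by blast
    from bchoice[OF this] obtain g where g: "\<And>z. z \<in> S \<Longrightarrow> g z \<in> W"
      "\<And>z. z \<in> S \<Longrightarrow> case g z of None \<Rightarrow> \<not> hits X (box z) \<omega> | Some (c, m) \<Rightarrow> hits X (cell z c) \<omega> \<and> hits Y (tube z c m) \<omega>"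
      by blast
    \<comment> \<open>The choice is made undefined outside \<open>S\<close> to be a member of the
      finite function space.\<close>
    have "hits X (DX (restrict g S) z) \<omega> = (restrict g S z \<noteq> None)" if "z \<in> S" for z
      using g(2)[OF that] that by (cases "g z") (auto simp: DX_def)
    moreover have "hits Y (DY (restrict g S) z) \<omega>" if "z \<in> T (restrict g S)" for z
      using g(2)[of z] that by (cases "g z") (auto simp: DY_def T_def)
    ultimately have "\<omega> \<in> G (restrict g S)"
      using \<omega> by (simp add: G_def)
    moreover have "restrict g S \<in> PiE S (\<lambda>_. W)" using g(1) by simp
    ultimately show "\<omega> \<in> (\<Union>g\<in>PiE S (\<lambda>_. W). G g)" by blast
  qed
  moreover have finPi: "finite (PiE S (\<lambda>_. W))" using fin W by (intro finite_PiE) auto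
  ultimately have "prob {\<omega> \<in> space M. \<forall>z\<in>S. \<forall>c\<in>I. hits X (cell z c) \<omega> \<longrightarrow> (\<exists>m\<in>J. hits Y (tube z c m) \<omega>)}
      \<le> prob (\<Union>g\<in>PiE S (\<lambda>_. W). G g)"
    using G_event by (intro finite_measure_mono sets.finite_UN) auto
  also have "\<dots> \<le> (\<Sum>g\<in>PiE S (\<lambda>_. W). prob (G g))"
    using G_event finPi by (intro finite_measure_subadditive_finite) auto
  also have "\<dots> \<le> (\<Sum>g\<in>PiE S (\<lambda>_. W). \<Prod>z\<in>S. wX (g z) * wY (g z))"
    using G_le by (rule sum_mono)
  \<comment> \<open>Distributivity turns the sum over all choices of reasons into a product whose
    factor is the same at every site.\<close>
  also have "\<dots> = (\<Prod>z\<in>S. \<Sum>wit\<in>W. wX wit * wY wit)"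
    using fin W by (intro prod_sum_PiE[symmetric]) auto
  also have "(\<Sum>wit\<in>W. wX wit * wY wit) =
      exp (- (lp * area_box)) + real (card I * card J) * ((lp * area_cell) * (lm * area_tube))"
    unfolding W_def using fin
    by (subst sum.insert) (auto simp: sum.reindex wX_def wY_def card_cartesian_product)
  finally show ?thesis by simp
qed

section \<open>Supersolutions built from barriers\<close>

text \<open>If the second derivative of \<open>\<psi>\<close> exceeded \<open>c\<close>, then
  \<open>P' - \<psi>'\<close> would vanish at \<open>x\<^sub>0\<close> and be negative just to the
  right, and by the mean value theorem \<open>P - \<psi>\<close> would drop below its local
  minimum.\<close>

lemma second_derivative_le_of_local_min_diff:
  fixes \<psi> P P' :: "real \<Rightarrow> real"
  assumes "open U" "x\<^sub>0 \<in> U" "Ck_on 2 U \<psi>"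
    and min: "eventually (\<lambda>x. P x\<^sub>0 - \<psi> x\<^sub>0 \<le> P x - \<psi> x) (nhds x\<^sub>0)"
    and P: "eventually (\<lambda>x. (P has_real_derivative P' x) (at x)) (nhds x\<^sub>0)"
    and P': "(P' has_real_derivative c) (at x\<^sub>0)"
  shows "deriv (deriv \<psi>) x\<^sub>0 \<le> c"
proof -
  \<comment> \<open>\<open>Ck_on\<close> speaks of Frechet derivatives; in direction 1 they are the
    ordinary derivative.\<close>
  define \<psi>' where "\<psi>' = (\<lambda>x. frechet_derivative \<psi> (at x) 1)"
  have \<psi>: "(\<psi> has_real_derivative \<psi>' x) (at x)" if "x \<in> U" for x
  proof -
    have "\<psi> differentiable (at x)"
      using assms(3) that by (simp add: numeral_2_eq_2)
    then have "(\<psi> has_derivative frechet_derivative \<psi> (at x)) (at x)"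
      by (simp add: frechet_derivative_works)
    moreover from this have "frechet_derivative \<psi> (at x) = (\<lambda>h. \<psi>' x * h)"
      unfolding \<psi>'_def
      by (auto simp: mult.commute dest!: has_derivative_bounded_linear simp: real_bounded_linear)
    ultimately show ?thesis
      by (simp add: has_field_derivative_def)
  qed
  have "\<psi>' differentiable (at x\<^sub>0)"
    using assms(2,3) by (simp add: numeral_2_eq_2 \<psi>'_def)
  then obtain D where D: "(\<psi>' has_real_derivative D) (at x\<^sub>0)"
    by (auto simp: real_differentiable_def)
  have "eventually (\<lambda>x. deriv \<psi> x = \<psi>' x) (nhds x\<^sub>0)"
    using assms(1,2) \<psi> by (auto simp: eventually_nhds intro!: exI[of _ U] DERIV_imp_deriv)
  then have "deriv (deriv \<psi>) x\<^sub>0 = D"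
    using D by (subst deriv_cong_ev[of _ \<psi>']) (auto intro: DERIV_imp_deriv)
  moreover have "D \<le> c"
  proof (rule ccontr)
    assume "\<not> D \<le> c"
    have "eventually (\<lambda>x. x \<in> U) (nhds x\<^sub>0)"
      using assms(1,2) by (simp add: eventually_nhds_in_open)
    with min P have "eventually (\<lambda>x. P x\<^sub>0 - \<psi> x\<^sub>0 \<le> P x - \<psi> x \<and>
        ((\<lambda>x. P x - \<psi> x) has_real_derivative P' x - \<psi>' x) (at x)) (nhds x\<^sub>0)"
      by eventually_elim (auto intro!: derivative_intros \<psi>)
    then obtain e where e: "e > 0" and loc: "\<And>x. dist x x\<^sub>0 < e \<Longrightarrow> P x\<^sub>0 - \<psi> x\<^sub>0 \<le> P x - \<psi> x \<and>
        ((\<lambda>x. P x - \<psi> x) has_real_derivative P' x - \<psi>' x) (at x)"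
      unfolding eventually_nhds_metric by blast
    have zero: "P' x\<^sub>0 - \<psi>' x\<^sub>0 = 0"
      using loc[of x\<^sub>0] e loc
      by (intro DERIV_local_min[of "\<lambda>x. P x - \<psi> x" _ x\<^sub>0 e]) (auto simp: dist_real_def abs_minus_commute)
    have "((\<lambda>x. P' x - \<psi>' x) has_real_derivative c - D) (at x\<^sub>0)"
      by (intro derivative_intros P' D)
    from DERIV_neg_dec_right[OF this] \<open>\<not> D \<le> c\<close>
    obtain \<delta> where \<delta>: "\<delta> > 0" "\<And>h. 0 < h \<Longrightarrow> h < \<delta> \<Longrightarrow> P' (x\<^sub>0 + h) - \<psi>' (x\<^sub>0 + h) < P' x\<^sub>0 - \<psi>' x\<^sub>0"
      by auto
    define s where "s = min e \<delta> / 2"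
    have s: "0 < s" "s < e" "s < \<delta>"
      using e \<delta>(1) by (auto simp: s_def)
    have "\<exists>z>x\<^sub>0. z < x\<^sub>0 + s \<and> (P (x\<^sub>0 + s) - \<psi> (x\<^sub>0 + s)) - (P x\<^sub>0 - \<psi> x\<^sub>0) = (x\<^sub>0 + s - x\<^sub>0) * (P' z - \<psi>' z)"
      using s loc by (intro MVT2) (auto simp: dist_real_def)
    then obtain z where z: "x\<^sub>0 < z" "z < x\<^sub>0 + s"
      "(P (x\<^sub>0 + s) - \<psi> (x\<^sub>0 + s)) - (P x\<^sub>0 - \<psi> x\<^sub>0) = s * (P' z - \<psi>' z)"
      by auto
    have "P' z - \<psi>' z < 0"
      using \<delta>(2)[of "z - x\<^sub>0"] z s zero by simp
    then have "s * (P' z - \<psi>' z) < 0"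
      using s by (simp add: mult_pos_neg)
    then show False
      using z(3) loc[of "x\<^sub>0 + s"] s by (simp add: dist_real_def)
  qed
  ultimately show ?thesis by simp
qed

text \<open>The curvature \<open>- k / (50 d)\<close> is so small that the flank still climbs at distances of several
  column widths \<open>d\<close>.\<close>

definition flank :: "real \<Rightarrow> real \<Rightarrow> real \<Rightarrow> real" where
  "flank k d t = k / 2 * \<bar>t\<bar> - k / (100 * d) * t\<^sup>2"

text \<open>The branches cross at a distance slightly below \<open>\<rho>\<close>, so the convex
  parabola is used only inside the obstacle. Taking the minimum makes the kinks at the crossings
  concave, where no test function can touch from below.\<close>

definition barrier :: "real \<Rightarrow> real \<Rightarrow> real \<Rightarrow> real \<Rightarrow> real" where
  "barrier k d \<rho> t = min (k / (2 * \<rho>) * t\<^sup>2) (flank k d t)"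

lemma flank_nonneg:
  assumes "0 \<le> k" "0 < d" "\<bar>t\<bar> \<le> 50 * d"
  shows "0 \<le> flank k d t"
proof -
  have "flank k d t = k * \<bar>t\<bar> / (100 * d) * (50 * d - \<bar>t\<bar>)"
    using assms by (simp add: flank_def field_simps power2_eq_square abs_mult_self_eq)
  also have "\<dots> \<ge> 0"
    using assms by (intro mult_nonneg_nonneg divide_nonneg_nonneg) auto
  finally show ?thesis .
qed

lemma flank_le:
  assumes "0 \<le> k" "0 < d"
  shows "flank k d t \<le> k / 2 * \<bar>t\<bar>"
  using assms by (simp add: flank_def)

text \<open>The difference is \<open>c * (\<bar>s\<bar> - \<bar>t\<bar>)\<close>, and the range
  \<open>25 * d\<close> keeps \<open>c\<close> between 0 and \<open>k / 2\<close>. With constant 1,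
  a horizontal error costs at most the same vertical error when the graph is covered by
  rectangles.\<close>

lemma flank_lipschitz:
  assumes "0 \<le> k" "k \<le> 1" "0 < d" "\<bar>s\<bar> \<le> 25 * d" "\<bar>t\<bar> \<le> 25 * d"
  shows "\<bar>flank k d s - flank k d t\<bar> \<le> \<bar>s - t\<bar>"
proof -
  define c where "c = k / 2 - k / (100 * d) * (\<bar>s\<bar> + \<bar>t\<bar>)"
  have "flank k d s - flank k d t = c * (\<bar>s\<bar> - \<bar>t\<bar>)"
    using assms(3) by (simp add: flank_def c_def field_simps power2_eq_square abs_mult_self_eq)
  moreover have "\<bar>c\<bar> \<le> 1"
  proof -
    have "k / (100 * d) * (\<bar>s\<bar> + \<bar>t\<bar>) \<le> k / (100 * d) * (50 * d)"
      using assms by (intro mult_left_mono) auto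
    also have "\<dots> = k / 2" using assms by simp
    finally have "k / (100 * d) * (\<bar>s\<bar> + \<bar>t\<bar>) \<le> k / 2" .
    moreover have "0 \<le> k / (100 * d) * (\<bar>s\<bar> + \<bar>t\<bar>)" using assms by simp
    ultimately show ?thesis
      using assms unfolding c_def by linarith
  qed
  ultimately have "\<bar>flank k d s - flank k d t\<bar> \<le> 1 * \<bar>\<bar>s\<bar> - \<bar>t\<bar>\<bar>"
    using mult_right_mono[of "\<bar>c\<bar>" 1 "\<bar>\<bar>s\<bar> - \<bar>t\<bar>\<bar>"] by (simp add: abs_mult)
  then show ?thesis using abs_triangle_ineq3[of s t] by simp
qed

text \<open>Up to distance \<open>\<rho>\<close> both functions lie between 0 and
  \<open>\<rho>\<close>; beyond it the flank is the smaller branch. Tubes around the flank therefore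
  also control the barrier.\<close>

lemma barrier_near_flank:
  assumes "0 \<le> k" "k \<le> 1" "0 < d" "0 < \<rho>" "\<rho> \<le> d"
  shows "\<bar>barrier k d \<rho> t - flank k d t\<bar> \<le> \<rho>"
proof (cases "\<bar>t\<bar> \<le> \<rho>")
  case True
  then have "k / 2 * \<bar>t\<bar> \<le> 1 * \<rho>"
    using assms by (intro mult_mono) auto
  moreover have "0 \<le> k / (2 * \<rho>) * t\<^sup>2" using assms by simp
  moreover have "0 \<le> flank k d t" using True assms by (intro flank_nonneg) auto
  ultimately show ?thesis
    using flank_le[of k d t] assms unfolding barrier_def by linarith
next
  case False
  have "k / 2 * \<bar>t\<bar> \<le> k / (2 * \<rho>) * t\<^sup>2"
  proof -
    have "k * \<bar>t\<bar> * \<rho> \<le> k * \<bar>t\<bar> * \<bar>t\<bar>" using False assms by (intro mult_left_mono) auto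
    then show ?thesis using assms by (simp add: field_simps power2_eq_square)
  qed
  then have "barrier k d \<rho> t = flank k d t"
    using flank_le[of k d t] assms unfolding barrier_def by linarith
  then show ?thesis using assms by simp
qed

lemma barrier_nonneg:
  assumes "0 \<le> k" "0 < d" "0 < \<rho>" "\<bar>t\<bar> \<le> 50 * d"
  shows "0 \<le> barrier k d \<rho> t"
  using assms flank_nonneg[of k d t] by (simp add: barrier_def)

text \<open>Within one column width a barrier rises by at most \<open>k * d / 2\<close>, so this
  leaves a margin of \<open>k * d / 4\<close> for the height differences between columns.\<close>

lemma barrier_ge_far:
  assumes "0 \<le> k" "0 < d" "0 < \<rho>" "\<rho> \<le> d" "2 * d \<le> \<bar>t\<bar>" "\<bar>t\<bar> \<le> 5 * d"
  shows "3 / 4 * k * d \<le> barrier k d \<rho> t"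
proof -
  have t2: "t\<^sup>2 = \<bar>t\<bar> * \<bar>t\<bar>" by (simp add: power2_eq_square)
  have "flank k d t - 3 / 4 * k * d = k / (100 * d) * (\<bar>t\<bar> * (50 * d - \<bar>t\<bar>) - 75 * d\<^sup>2)"
    using assms by (simp add: flank_def t2 field_simps power2_eq_square)
  moreover have "75 * d\<^sup>2 \<le> \<bar>t\<bar> * (50 * d - \<bar>t\<bar>)"
  proof -
    have "(2 * d) * (45 * d) \<le> \<bar>t\<bar> * (50 * d - \<bar>t\<bar>)" using assms by (intro mult_mono) auto
    then show ?thesis using zero_le_square[of d] unfolding power2_eq_square by linarith
  qed
  moreover have "0 \<le> k / (100 * d)" using assms by simp
  ultimately have "0 \<le> flank k d t - 3 / 4 * k * d"
    by (metis diff_ge_0_iff_ge mult_nonneg_nonneg)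
  then have "3 / 4 * k * d \<le> flank k d t" by simp
  moreover have "3 / 4 * k * d \<le> k / (2 * \<rho>) * t\<^sup>2"
  proof -
    have "\<rho> * d * 3 \<le> \<bar>t\<bar> * \<bar>t\<bar> * 2"
    proof -
      have "d * d \<ge> \<rho> * d" using assms by simp
      moreover have "(2*d)*(2*d) \<le> \<bar>t\<bar> * \<bar>t\<bar>" using assms by (intro mult_mono) auto
      moreover have "0 \<le> \<rho> * d" using assms by simp
      ultimately show ?thesis by linarith
    qed
    then have "k * (\<rho> * d * 3) \<le> k * (\<bar>t\<bar> * \<bar>t\<bar> * 2)" using assms by (intro mult_left_mono)
    then show ?thesis using assms by (simp add: field_simps t2)
  qed
  ultimately show ?thesis by (simp add: barrier_def)
qed

lemma continuous_barrier: "isCont (barrier k d \<rho>) t"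
  unfolding barrier_def flank_def by (intro continuous_intros)

text \<open>The two alternatives say which of the two functions in the minimum is attained at \<open>x\<^sub>0\<close>; the
  convex kink of the flank at \<open>a\<close> is never attained.\<close>

lemma barrier_touching_below:
  assumes k: "0 < k" "k \<le> 1" "0 < d" "0 < \<rho>" "\<rho> \<le> d"
    and U: "open U" "x\<^sub>0 \<in> U" "Ck_on 2 U \<psi>"
    and min: "eventually (\<lambda>x. barrier k d \<rho> (x\<^sub>0 - a) - \<psi> x\<^sub>0 \<le> barrier k d \<rho> (x - a) - \<psi> x) (nhds x\<^sub>0)"
  shows "deriv (deriv \<psi>) x\<^sub>0 \<le> - (k / (50 * d)) \<or>
    deriv (deriv \<psi>) x\<^sub>0 \<le> k / \<rho> \<and> \<bar>x\<^sub>0 - a\<bar> \<le> \<rho> \<and>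
    0 \<le> barrier k d \<rho> (x\<^sub>0 - a) \<and> barrier k d \<rho> (x\<^sub>0 - a) \<le> \<rho>"
proof (cases "k / (2 * \<rho>) * (x\<^sub>0 - a)\<^sup>2 \<le> flank k d (x\<^sub>0 - a)")
  case True
  then have eq: "barrier k d \<rho> (x\<^sub>0 - a) = k / (2 * \<rho>) * (x\<^sub>0 - a)\<^sup>2"
    by (simp add: barrier_def)
  \<comment> \<open>The barrier lies below the parabola and agrees with it at
    \<open>x\<^sub>0\<close>, so \<open>\<psi>\<close> touches the parabola from below as
    well.\<close>
  have "deriv (deriv \<psi>) x\<^sub>0 \<le> k / \<rho>"
  proof (rule second_derivative_le_of_local_min_diff[OF U, where P = "\<lambda>x. k / (2 * \<rho>) * (x - a)\<^sup>2" and P' = "\<lambda>x. k / \<rho> * (x - a)"])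
    show "eventually (\<lambda>x. k / (2 * \<rho>) * (x\<^sub>0 - a)\<^sup>2 - \<psi> x\<^sub>0 \<le> k / (2 * \<rho>) * (x - a)\<^sup>2 - \<psi> x) (nhds x\<^sub>0)"
      using min by eventually_elim (simp add: eq, simp add: barrier_def)
    show "eventually (\<lambda>x. ((\<lambda>x. k / (2 * \<rho>) * (x - a)\<^sup>2) has_real_derivative k / \<rho> * (x - a)) (at x)) (nhds x\<^sub>0)"
      using k by (auto intro!: always_eventually derivative_eq_intros simp: field_simps)
    show "((\<lambda>x. k / \<rho> * (x - a)) has_real_derivative k / \<rho>) (at x\<^sub>0)"
      using k by (auto intro!: derivative_eq_intros)
  qed
  moreover have "\<bar>x\<^sub>0 - a\<bar> \<le> \<rho>"
  proof (rule ccontr)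
    assume "\<not> ?thesis"
    then have "k * \<bar>x\<^sub>0 - a\<bar> * \<rho> < k * \<bar>x\<^sub>0 - a\<bar> * \<bar>x\<^sub>0 - a\<bar>" using k by (intro mult_strict_left_mono) auto
    then have "k / 2 * \<bar>x\<^sub>0 - a\<bar> < k / (2 * \<rho>) * (x\<^sub>0 - a)\<^sup>2"
      using k by (simp add: field_simps power2_eq_square)
    then show False using True flank_le[of k d "x\<^sub>0 - a"] k by linarith
  qed
  moreover have "barrier k d \<rho> (x\<^sub>0 - a) \<le> \<rho>"
  proof -
    have "k / 2 * \<bar>x\<^sub>0 - a\<bar> \<le> 1 * \<rho>" using k \<open>\<bar>x\<^sub>0 - a\<bar> \<le> \<rho>\<close> by (intro mult_mono) auto
    then show ?thesis using flank_le[of k d "x\<^sub>0 - a"] k by (simp add: barrier_def)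
  qed
  moreover have "0 \<le> barrier k d \<rho> (x\<^sub>0 - a)"
    using k \<open>\<bar>x\<^sub>0 - a\<bar> \<le> \<rho>\<close> by (intro barrier_nonneg) auto
  ultimately show ?thesis by blast
next
  case False
  then have eq: "barrier k d \<rho> (x\<^sub>0 - a) = flank k d (x\<^sub>0 - a)"
    by (simp add: barrier_def)
  \<comment> \<open>At \<open>a\<close> both branches vanish, which belongs to the first case. Away
    from \<open>a\<close> the flank is smooth.\<close>
  have "x\<^sub>0 \<noteq> a" using False by (auto simp: flank_def)
  define s where "s = sgn (x\<^sub>0 - a)"
  define P where "P = (\<lambda>x. k / 2 * (s * (x - a)) - k / (100 * d) * (x - a)\<^sup>2)"
  have "deriv (deriv \<psi>) x\<^sub>0 \<le> - (k / (50 * d))"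
  proof (rule second_derivative_le_of_local_min_diff[OF U, where P = P
        and P' = "\<lambda>x. k / 2 * s - k / (50 * d) * (x - a)"])
    have "eventually (\<lambda>x. dist x x\<^sub>0 < \<bar>x\<^sub>0 - a\<bar>) (nhds x\<^sub>0)"
      using \<open>x\<^sub>0 \<noteq> a\<close> unfolding eventually_nhds_metric by (intro exI[of _ "\<bar>x\<^sub>0 - a\<bar>"]) auto
    then have "eventually (\<lambda>x. flank k d (x - a) = P x) (nhds x\<^sub>0)"
    proof eventually_elim
      case (elim x)
      then have "\<bar>x - a\<bar> = s * (x - a)"
        by (cases "x\<^sub>0 > a") (auto simp: dist_real_def s_def)
      then show ?case by (simp add: flank_def P_def)
    qed
    note near = this
    from near have "flank k d (x\<^sub>0 - a) = P x\<^sub>0"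
      by (rule eventually_nhds_x_imp_x)
    with eq have eq': "barrier k d \<rho> (x\<^sub>0 - a) = P x\<^sub>0" by simp
    from min near show "eventually (\<lambda>x. P x\<^sub>0 - \<psi> x\<^sub>0 \<le> P x - \<psi> x) (nhds x\<^sub>0)"
      unfolding eq' by eventually_elim (simp add: barrier_def)
    show "eventually (\<lambda>x. (P has_real_derivative k / 2 * s - k / (50 * d) * (x - a)) (at x)) (nhds x\<^sub>0)"
      unfolding P_def using k
      by (auto intro!: always_eventually derivative_eq_intros simp: field_simps)
    show "((\<lambda>x. k / 2 * s - k / (50 * d) * (x - a)) has_real_derivative - (k / (50 * d))) (at x\<^sub>0)"
      using k by (auto intro!: derivative_eq_intros)
  qed
  then show ?thesis by blast
qed

text \<open>Flanks tend to minus infinity far away, so \<open>v\<close> is a minimum over the seven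
  nearest columns only. Barriers three or four columns away lie strictly above \<open>v\<close>,
  hence the change of this window between columns goes unnoticed. The last conclusion confines the
  graph to neighbourhoods of flanks, for use against the negative points.\<close>

lemma exists_supersolution_through_points:
  fixes a b :: "int \<Rightarrow> real" and g :: "real \<times> real \<Rightarrow> real"
  assumes k: "0 < k" "k \<le> 1" "0 < d" "0 < \<rho>" "\<rho> \<le> d" and h: "20 * h < k * d"
    and a: "\<And>i. of_int i * d \<le> a i" "\<And>i. a i < (of_int i + 1) * d"
    and b: "\<And>i. 0 < b i" "\<And>i j. \<bar>i - j\<bar> \<le> 4 \<Longrightarrow> \<bar>b i - b j\<bar> \<le> 5 * h"
    and g_nonneg: "\<And>p. 0 \<le> g p"
    and g_obstacle: "\<And>i x y. \<bar>x - a i\<bar> \<le> \<rho> \<Longrightarrow> \<bar>y - b i\<bar> \<le> \<rho> \<Longrightarrow> 2 * k / \<rho> \<le> g (x, y)"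
  shows "\<exists>v. (\<forall>x. 0 < v x) \<and> viscosity_supersolution g (k / (50 * d)) v \<and>
    (\<forall>x. \<exists>i. \<bar>x - a i\<bar> \<le> 4 * d \<and> \<bar>v x - b i - flank k d (x - a i)\<bar> \<le> \<rho>)"
proof -
  define W where "W i x = b i + barrier k d \<rho> (x - a i)" for i x
  define col where "col x = \<lfloor>x / d\<rfloor>" for x
  define v where "v x = Min ((\<lambda>i. W i x) ` {col x - 3..col x + 3})" for x
  have col: "of_int (col x) * d \<le> x" "x < (of_int (col x) + 1) * d" for x
    using k floor_divide_lower[of d x] floor_divide_upper[of d x] by (auto simp: col_def)
  have near: "\<bar>x - a i\<bar> \<le> (m + 1) * d" if "\<bar>of_int i - of_int (col x)\<bar> \<le> m" for i x m
  proof -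
    have "\<bar>of_int i - of_int (col x)\<bar> * d \<le> m * d" using that k by (intro mult_right_mono) auto
    then have "\<bar>of_int i * d - of_int (col x) * d\<bar> \<le> m * d"
      using k by (simp flip: left_diff_distrib add: abs_mult)
    then show ?thesis using a[of i] col[of x] unfolding distrib_right abs_le_iff by linarith
  qed
  have far: "2 * d \<le> \<bar>x - a i\<bar>" if "3 \<le> \<bar>i - col x\<bar>" for i x
  proof -
    have "3 * d \<le> of_int \<bar>i - col x\<bar> * d" using that k by (intro mult_right_mono) auto
    then have "3 * d \<le> \<bar>of_int i * d - of_int (col x) * d\<bar>"
      using k by (simp flip: left_diff_distrib add: abs_mult)
    then show ?thesis using a[of i] col[of x] unfolding distrib_right by linarith
  qed
  have attained: "\<exists>i. \<bar>i - col x\<bar> \<le> 3 \<and> v x = W i x" for x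
  proof -
    have "v x \<in> (\<lambda>i. W i x) ` {col x - 3..col x + 3}" unfolding v_def by (intro Min_in) auto
    then obtain i where "i \<in> {col x - 3..col x + 3}" "v x = W i x" by blast
    then show ?thesis by (intro exI[of _ i]) (auto simp: abs_le_iff)
  qed
  have v_le3: "v x \<le> W i x" if "\<bar>i - col x\<bar> \<le> 3" for i x
    unfolding v_def using that by (intro Min_le imageI) (auto simp: abs_le_iff)
  \<comment> \<open>Compared with the barrier of the column of \<open>x\<close>, the gain
    \<open>3 / 4 * k * d - k / 2 * d\<close> exceeds \<open>5 * h\<close> exactly by
    \<open>20 * h < k * d\<close>.\<close>
  have v_less_far: "v x < W i x" if i: "3 \<le> \<bar>i - col x\<bar>" "\<bar>i - col x\<bar> \<le> 4" for i x
  proof -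
    have "\<bar>x - a (col x)\<bar> \<le> d" using near[of "col x" x 0] by simp
    then have "k / 2 * \<bar>x - a (col x)\<bar> \<le> k / 2 * d" using k by (intro mult_left_mono) auto
    then have "W (col x) x \<le> b (col x) + k / 2 * d"
      using flank_le[of k d "x - a (col x)"] k unfolding W_def barrier_def by linarith
    moreover have "\<bar>of_int i - of_int (col x)\<bar> \<le> (4::real)"
      using i(2) by (metis of_int_abs of_int_diff of_int_le_numeral_iff)
    then have "\<bar>x - a i\<bar> \<le> 5 * d" using near[of i x 4] by simp
    then have "3 / 4 * k * d \<le> barrier k d \<rho> (x - a i)"
      using far[OF i(1)] k by (intro barrier_ge_far) auto
    then have "b i + 3 / 4 * k * d \<le> W i x" by (simp add: W_def)
    moreover have "\<bar>b i - b (col x)\<bar> \<le> 5 * h" using b(2) i(2) .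
    moreover have "v x \<le> W (col x) x" by (rule v_le3) simp
    ultimately show ?thesis using h by (simp add: abs_le_iff)
  qed
  have v_le: "v x \<le> W i x" if "\<bar>i - col x\<bar> \<le> 4" for i x
    using v_le3[of i x] v_less_far[of i x] that by linarith
  have col_near: "eventually (\<lambda>y. \<bar>col y - col x\<bar> \<le> 1) (nhds x)" for x
    unfolding eventually_nhds_metric
  proof (intro exI[of _ d] conjI allI impI)
    fix y assume "dist y x < d"
    then have "\<bar>y / d - x / d\<bar> < 1"
      using k by (simp add: dist_real_def flip: diff_divide_distrib)
    then show "\<bar>col y - col x\<bar> \<le> 1" unfolding col_def by linarith
  qed (use k in simp)
  have "viscosity_supersolution g (k / (50 * d)) v"
    unfolding viscosity_supersolution_def
  proof (intro conjI allI impI)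
    show "lower_semicontinuous v"
      unfolding lower_semicontinuous_def
    proof (intro allI impI)
      fix x c assume c: "c < v x"
      have "eventually (\<lambda>y. c < W i y) (nhds x)" if "i \<in> {col x - 4..col x + 4}" for i
      proof -
        have "isCont (W i) x"
          unfolding W_def by (intro continuous_intros isCont_o2[OF _ continuous_barrier])
        moreover have "c < W i x" using c v_le[of i x] that by (force simp: abs_le_iff)
        ultimately show ?thesis
          unfolding isCont_def tendsto_at_iff_tendsto_nhds by (rule order_tendstoD(1))
      qed
      \<comment> \<open>The column changes by at most one near \<open>x\<close>, so these nine
        barriers include every window that occurs.\<close>
      then have "eventually (\<lambda>y. \<forall>i\<in>{col x - 4..col x + 4}. c < W i y) (nhds x)"
        by (intro eventually_ball_finite) auto
      with col_near[of x] show "eventually (\<lambda>y. c < v y) (nhds x)"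
      proof eventually_elim
        case (elim y)
        obtain i where "\<bar>i - col y\<bar> \<le> 3" "v y = W i y" using attained by blast
        moreover from this elim(1) have "i \<in> {col x - 4..col x + 4}"
          unfolding atLeastAtMost_iff by linarith
        ultimately show ?case using elim(2) by simp
      qed
    qed
    fix x\<^sub>0 U \<psi>
    assume U: "open U" "x\<^sub>0 \<in> U" "Ck_on 2 U \<psi>"
      and min: "eventually (\<lambda>x. v x\<^sub>0 - \<psi> x\<^sub>0 \<le> v x - \<psi> x) (nhds x\<^sub>0)"
    obtain i where i: "\<bar>i - col x\<^sub>0\<bar> \<le> 3" "v x\<^sub>0 = W i x\<^sub>0" using attained by blast
    \<comment> \<open>A minimiser at most two columns away stays above \<open>v\<close> at all
      nearby points, so \<open>\<psi>\<close> touches this one barrier from below.\<close>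
    with v_less_far[of i x\<^sub>0] have "\<bar>i - col x\<^sub>0\<bar> \<le> 2" by linarith
    from col_near[of x\<^sub>0] min
    have "eventually (\<lambda>x. barrier k d \<rho> (x\<^sub>0 - a i) - \<psi> x\<^sub>0 \<le> barrier k d \<rho> (x - a i) - \<psi> x) (nhds x\<^sub>0)"
    proof eventually_elim
      case (elim x)
      have "v x \<le> W i x" using elim(1) \<open>\<bar>i - col x\<^sub>0\<bar> \<le> 2\<close> by (intro v_le) linarith
      with elim(2) i(2) show ?case by (simp add: W_def)
    qed
    from barrier_touching_below[OF k U this]
    show "deriv (deriv \<psi>) x\<^sub>0 - g (x\<^sub>0, v x\<^sub>0) + k / (50 * d) \<le> 0"
    proof
      assume "deriv (deriv \<psi>) x\<^sub>0 \<le> - (k / (50 * d))"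
      then show ?thesis using g_nonneg[of "(x\<^sub>0, v x\<^sub>0)"] by linarith
    next
      assume *: "deriv (deriv \<psi>) x\<^sub>0 \<le> k / \<rho> \<and> \<bar>x\<^sub>0 - a i\<bar> \<le> \<rho> \<and>
        0 \<le> barrier k d \<rho> (x\<^sub>0 - a i) \<and> barrier k d \<rho> (x\<^sub>0 - a i) \<le> \<rho>"
      \<comment> \<open>Inside the obstacle the force is twice the curvature
        \<open>k / \<rho>\<close>; the other half pays for the constant
        \<open>k / (50 * d)\<close>.\<close>
      then have "2 * k / \<rho> \<le> g (x\<^sub>0, v x\<^sub>0)"
        by (intro g_obstacle[of _ i]) (auto simp: i(2) W_def)
      moreover have "k / (50 * d) \<le> k / \<rho>"
        using k by (intro divide_left_mono) auto
      ultimately show ?thesis using * by simp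
    qed
  qed
  moreover have "0 < v x \<and> (\<exists>i. \<bar>x - a i\<bar> \<le> 4 * d \<and> \<bar>v x - b i - flank k d (x - a i)\<bar> \<le> \<rho>)" for x
  proof -
    obtain i where i: "\<bar>i - col x\<bar> \<le> 3" "v x = W i x" using attained by blast
    have "\<bar>of_int i - of_int (col x)\<bar> \<le> (3::real)"
      using i(1) by (metis of_int_abs of_int_diff of_int_le_numeral_iff)
    then have "\<bar>x - a i\<bar> \<le> 4 * d" using near[of i x 3] by simp
    moreover from this have "0 \<le> barrier k d \<rho> (x - a i)" using k by (intro barrier_nonneg) auto
    ultimately show ?thesis
      using barrier_near_flank[of k d \<rho> "x - a i"] k b(1)[of i] i(2)
      by (intro conjI exI[of _ i]) (auto simp: W_def)
  qed
  ultimately show ?thesis by blast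
qed

section \<open>Bounds for the obstacle force\<close>

context
  fixes k \<rho> \<alpha> :: real and \<phi> :: "real \<times> real \<Rightarrow> real" and X :: "nat \<Rightarrow> 'w \<Rightarrow> real \<times> real" and \<omega> :: 'w
  assumes k: "0 < k" "0 < \<rho>" and \<phi>: "\<And>p. 0 \<le> \<phi> p" "\<And>p. p \<notin> ball 0 \<alpha> \<Longrightarrow> \<phi> p = 0"
    and locally_finite: "\<And>A. bounded A \<Longrightarrow> finite {j. X j \<omega> \<in> A}"
begin

text \<open>The rescaled bump vanishes outside radius \<open>\<alpha> * \<rho>\<close>, so local
  finiteness leaves finitely many nonzero terms. Without summability \<open>suminf\<close> would
  carry no information.\<close>

lemma summable_obstacle_force:
  "summable (\<lambda>j. 2 * k / \<rho> * \<phi> ((x - fst (X j \<omega>)) / \<rho>, (y - snd (X j \<omega>)) / \<rho>))"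
proof (rule summable_finite)
  show "finite {j. X j \<omega> \<in> ball (x, y) (\<alpha> * \<rho>)}" by (rule locally_finite) simp
  fix j assume j: "j \<notin> {j. X j \<omega> \<in> ball (x, y) (\<alpha> * \<rho>)}"
  have "((x - fst (X j \<omega>)) / \<rho>, (y - snd (X j \<omega>)) / \<rho>) = (1 / \<rho>) *\<^sub>R ((x, y) - X j \<omega>)"
    by (simp add: prod_eq_iff)
  then have "norm ((x - fst (X j \<omega>)) / \<rho>, (y - snd (X j \<omega>)) / \<rho>) = dist (x, y) (X j \<omega>) / \<rho>"
    using k by (simp add: dist_norm del: scaleR_Pair)
  then have "((x - fst (X j \<omega>)) / \<rho>, (y - snd (X j \<omega>)) / \<rho>) \<notin> ball 0 \<alpha>"
    using j k by (simp add: pos_le_divide_eq not_less)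
  then show "2 * k / \<rho> * \<phi> ((x - fst (X j \<omega>)) / \<rho>, (y - snd (X j \<omega>)) / \<rho>) = 0"
    using \<phi>(2) by simp
qed

lemma obstacle_force_nonneg: "0 \<le> obstacle_force k \<phi> X \<rho> \<omega> p"
  unfolding obstacle_force_def using k \<phi>(1) summable_obstacle_force
  by (auto simp: case_prod_beta intro!: suminf_nonneg)

lemma obstacle_force_ge:
  assumes \<phi>1: "\<And>p. p \<in> {-1..1} \<times> {-1..1} \<Longrightarrow> 1 \<le> \<phi> p"
    and x: "\<bar>x - fst (X j \<omega>)\<bar> \<le> \<rho>" and y: "\<bar>y - snd (X j \<omega>)\<bar> \<le> \<rho>"
  shows "2 * k / \<rho> \<le> obstacle_force k \<phi> X \<rho> \<omega> (x, y)"
proof -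
  have "1 \<le> \<phi> ((x - fst (X j \<omega>)) / \<rho>, (y - snd (X j \<omega>)) / \<rho>)"
    using x y k by (intro \<phi>1) (auto simp: abs_le_iff field_simps)
  then have "2 * k / \<rho> * 1 \<le> 2 * k / \<rho> * \<phi> ((x - fst (X j \<omega>)) / \<rho>, (y - snd (X j \<omega>)) / \<rho>)"
    using k by (intro mult_left_mono) auto
  also have "\<dots> = (\<Sum>i\<in>{j}. 2 * k / \<rho> * \<phi> ((x - fst (X i \<omega>)) / \<rho>, (y - snd (X i \<omega>)) / \<rho>))"
    by simp
  also have "\<dots> \<le> obstacle_force k \<phi> X \<rho> \<omega> (x, y)"
    unfolding obstacle_force_def prod.case using k \<phi>(1)
    by (intro sum_le_suminf summable_obstacle_force) auto
  finally show ?thesis by simp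
qed

end

section \<open>Lipschitz percolation\<close>

text \<open>\<open>C\<close> is the set of closed sites. Gaining height costs a closed site, which
  makes high paths improbable; the free diagonal descent is what makes the top of the reachable set
  Lipschitz.\<close>

definition lip_step :: "(int \<times> int) set \<Rightarrow> int \<times> int \<Rightarrow> int \<times> int \<Rightarrow> bool" where
  "lip_step C x y \<longleftrightarrow> (fst y = fst x \<and> snd y = snd x + 1 \<and> y \<in> C) \<or>
     (\<bar>fst y - fst x\<bar> = 1 \<and> snd y = snd x - 1)"

text \<open>Up steps are recognised by height alone, so the walk determines, without reference to
  \<open>C\<close>, which sites have to be closed.\<close>

fun climbs :: "int \<times> int \<Rightarrow> (int \<times> int) list \<Rightarrow> (int \<times> int) list" where
  "climbs x [] = []"
| "climbs x (y # ys) = (if snd y = snd x + 1 then y # climbs y ys else climbs y ys)"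

fun walks :: "int \<times> int \<Rightarrow> nat \<Rightarrow> (int \<times> int) list set" where
  "walks x 0 = {[]}"
| "walks x (Suc N) =
    (\<Union>y\<in>{(fst x, snd x + 1), (fst x + 1, snd x - 1), (fst x - 1, snd x - 1)}. (#) y ` walks y N)"

lemma finite_walks: "finite (walks x N)"
  by (induction N arbitrary: x) auto

lemma card_walks_le: "card (walks x N) \<le> 3 ^ N"
proof (induction N arbitrary: x)
  case (Suc N)
  let ?Y = "{(fst x, snd x + 1), (fst x + 1, snd x - 1), (fst x - 1, snd x - 1)}"
  have "card (walks x (Suc N)) \<le> (\<Sum>y\<in>?Y. card ((#) y ` walks y N))"
    unfolding walks.simps by (rule card_UN_le) simp
  also have "\<dots> \<le> (\<Sum>y\<in>?Y. 3 ^ N)"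
    by (intro sum_mono) (use Suc in \<open>simp add: card_image\<close>)
  also have "\<dots> \<le> 3 * 3 ^ N"
    using card_insert_le_m1[of 3 "{(fst x + 1, snd x - 1), (fst x - 1, snd x - 1)}"]
    by (simp add: card_insert_if)
  finally show ?case by simp
qed simp

lemma set_climbs_subset: "set (climbs x xs) \<subseteq> set xs"
proof (induction xs arbitrary: x)
  case (Cons y ys)
  show ?case using Cons[of y] by auto
qed simp

lemma distinct_climbs: "distinct xs \<Longrightarrow> distinct (climbs x xs)"
proof (induction xs arbitrary: x)
  case (Cons y ys)
  then show ?case using set_climbs_subset[of y ys] by auto
qed simp

text \<open>An up step raises the height by one and every other step lowers it by one.\<close>

lemma lip_path:
  assumes "rtrancl_path (lip_step C) x xs y"
  shows "snd y = snd x + 2 * int (length (climbs x xs)) - int (length xs)"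
    and "\<bar>fst y - fst x\<bar> \<le> int (length xs)"
    and "set (climbs x xs) \<subseteq> C"
    and "xs \<in> walks x (length xs)"
proof -
  have "snd y = snd x + 2 * int (length (climbs x xs)) - int (length xs) \<and>
    \<bar>fst y - fst x\<bar> \<le> int (length xs) \<and> set (climbs x xs) \<subseteq> C \<and> xs \<in> walks x (length xs)"
    using assms
  proof induction
    case (step x y ys z)
    from step.hyps(1) have y: "y = (fst x, snd x + 1) \<and> y \<in> C \<or>
        y = (fst x + 1, snd x - 1) \<or> y = (fst x - 1, snd x - 1)"
      by (auto simp: lip_step_def prod_eq_iff abs_eq_iff)
    show ?case
    proof (intro conjI)
      show "y # ys \<in> walks x (length (y # ys))"
        using y step.IH by auto
    qed (use y step.IH in auto)
  qed auto
  then show "snd y = snd x + 2 * int (length (climbs x xs)) - int (length xs)"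
    and "\<bar>fst y - fst x\<bar> \<le> int (length xs)"
    and "set (climbs x xs) \<subseteq> C"
    and "xs \<in> walks x (length xs)" by auto
qed

text \<open>Take one plus the greatest reachable height: maximality makes that site open, the
  diagonal steps bound the increments, and the empty path shows that height 0 is reachable in every
  column.\<close>

lemma lipschitz_function_if_heights_bounded:
  assumes bounded: "\<And>i. \<exists>N. \<forall>s n. (lip_step C)\<^sup>*\<^sup>* (s, 0) (i, n) \<longrightarrow> n \<le> N"
  shows "\<exists>\<beta> :: int \<Rightarrow> int. \<forall>i. 1 \<le> \<beta> i \<and> \<bar>\<beta> (i + 1) - \<beta> i\<bar> \<le> 1 \<and> (i, \<beta> i) \<notin> C"
proof -
  define reach where "reach i n \<longleftrightarrow> (\<exists>s. (lip_step C)\<^sup>*\<^sup>* (s, 0) (i, n))" for i n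
  have reach0: "reach i 0" for i by (auto simp: reach_def)
  have reach_step: "reach j m" if "reach i n" "lip_step C (i, n) (j, m)" for i j n m
    using that unfolding reach_def by (meson rtranclp.rtrancl_into_rtrancl)
  have "\<exists>n. reach i n \<and> (\<forall>m. reach i m \<longrightarrow> m \<le> n)" for i
  proof -
    obtain N where N: "\<And>n. reach i n \<Longrightarrow> n \<le> N" using bounded[of i] by (auto simp: reach_def)
    let ?A = "{n. reach i n \<and> 0 \<le> n}"
    have "finite ?A" by (rule finite_subset[of _ "{0..N}"]) (auto dest: N)
    moreover have "0 \<in> ?A" using reach0 by simp
    ultimately have max: "Max ?A \<in> ?A" "\<And>n. n \<in> ?A \<Longrightarrow> n \<le> Max ?A"
      using Max_in[of ?A] by auto
    have "m \<le> Max ?A" if "reach i m" for m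
      using max(1) max(2)[of m] that by (cases "0 \<le> m") auto
    with max(1) show ?thesis by blast
  qed
  then obtain top where top: "\<And>i. reach i (top i)" "\<And>i m. reach i m \<Longrightarrow> m \<le> top i"
    by metis
  have "0 \<le> top i" for i using top(2) reach0 .
  moreover have "(i, top i + 1) \<notin> C" for i
  proof
    assume "(i, top i + 1) \<in> C"
    then have "reach i (top i + 1)" by (intro reach_step[OF top(1)[of i]]) (simp add: lip_step_def)
    then show False using top(2)[of i "top i + 1"] by simp
  qed
  moreover have "reach (i + 1) (top i - 1)" "reach i (top (i + 1) - 1)" for i
    by (rule reach_step[OF top(1)[of i]], simp add: lip_step_def)
      (rule reach_step[OF top(1)[of "i + 1"]], simp add: lip_step_def)
  then have "top i - 1 \<le> top (i + 1)" "top (i + 1) - 1 \<le> top i" for i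
    using top(2) by blast+
  ultimately show ?thesis
    by (intro exI[of _ "\<lambda>i. top i + 1"]) (simp add: abs_le_iff algebra_simps)
qed

text \<open>Peierls argument: an admissible path that ends at nonnegative height visits, after removal
  of loops, at least half as many closed sites as it has steps.\<close>

lemma (in prob_space) lipschitz_percolation:
  fixes closed :: "int \<times> int \<Rightarrow> 'a set"
  assumes events: "\<And>z. closed z \<in> events"
    and bound: "\<And>S. finite S \<Longrightarrow> prob (space M \<inter> (\<Inter>z\<in>S. closed z)) \<le> (1 / 18) ^ (2 * card S)"
  shows "AE \<omega> in M. \<exists>\<beta> :: int \<Rightarrow> int. \<forall>i. 1 \<le> \<beta> i \<and> \<bar>\<beta> (i + 1) - \<beta> i\<bar> \<le> 1 \<and> \<omega> \<notin> closed (i, \<beta> i)"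
proof -
  \<comment> \<open>\<open>N \<le> 2 * length (climbs (s, 0) xs)\<close> says that the walk ends at
    nonnegative height. In \<open>E\<close>, only starts within \<open>N\<close> columns of
    \<open>i\<close> matter, as a step changes the column by at most one.\<close>
  define bad where "bad s N = {xs \<in> walks (s, 0) N. distinct xs \<and> N \<le> 2 * length (climbs (s, 0) xs)}"
    for s :: int and N :: nat
  define Q where "Q s xs = space M \<inter> (\<Inter>z\<in>set (climbs (s, 0) xs). closed z)" for s :: int and xs
  define E where "E i N = (\<Union>s\<in>{i - int N..i + int N}. \<Union>xs\<in>bad s N. Q s xs)" for i N
  have fin: "finite (bad s N)" for s N
    unfolding bad_def using finite_walks by auto
  have Q: "Q s xs \<in> events" for s xs
  proof (cases "climbs (s, 0) xs = []")
    case False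
    then show ?thesis unfolding Q_def using events by (intro sets.Int sets.finite_INT) auto
  qed (simp add: Q_def)
  have E: "E i N \<in> events" for i N
    unfolding E_def using fin Q by (intro sets.finite_UN) auto
  have Q_le: "prob (Q s xs) \<le> (1 / 18) ^ N" if "xs \<in> bad s N" for s xs N
  proof -
    have "card (set (climbs (s, 0) xs)) = length (climbs (s, 0) xs)"
      using that by (simp add: bad_def distinct_card distinct_climbs)
    then have "prob (Q s xs) \<le> (1 / 18) ^ (2 * length (climbs (s, 0) xs))"
      unfolding Q_def using bound[of "set (climbs (s, 0) xs)"] by simp
    also have "\<dots> \<le> (1 / 18) ^ N"
      using that by (intro power_decreasing) (auto simp: bad_def)
    finally show ?thesis .
  qed
  have E_le: "prob (E i N) \<le> (1 / 2) ^ N" for i N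
  proof -
    have inner: "prob (\<Union>xs\<in>bad s N. Q s xs) \<le> 3 ^ N * (1 / 18) ^ N" for s
    proof -
      have "prob (\<Union>xs\<in>bad s N. Q s xs) \<le> (\<Sum>xs\<in>bad s N. prob (Q s xs))"
        using fin Q by (intro finite_measure_subadditive_finite) auto
      also have "\<dots> \<le> real (card (bad s N)) * (1 / 18) ^ N"
        using Q_le by (intro sum_bounded_above)
      also have "\<dots> \<le> 3 ^ N * (1 / 18) ^ N"
      proof (intro mult_right_mono)
        have "card (bad s N) \<le> card (walks (s, 0) N)"
          by (intro card_mono finite_walks) (auto simp: bad_def)
        also have "\<dots> \<le> 3 ^ N" by (rule card_walks_le)
        finally have "real (card (bad s N)) \<le> real (3 ^ N)" by (rule of_nat_mono)
        then show "real (card (bad s N)) \<le> 3 ^ N" by simp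
      qed simp
      finally show ?thesis .
    qed
    have "prob (E i N) \<le> (\<Sum>s\<in>{i - int N..i + int N}. prob (\<Union>xs\<in>bad s N. Q s xs))"
      unfolding E_def using fin Q by (intro finite_measure_subadditive_finite) auto
    also have "\<dots> \<le> real (card {i - int N..i + int N}) * (3 ^ N * (1 / 18) ^ N)"
      using inner by (intro sum_bounded_above)
    \<comment> \<open>The constant 18 is twice 9: one factor \<open>3 ^ N\<close> bounds the number
      of starting columns, the other the number of walks, and a summable \<open>(1 / 2) ^ N\<close>
      remains.\<close>
    also have "\<dots> \<le> 3 ^ N * (3 ^ N * (1 / 18) ^ N)"
    proof (intro mult_right_mono)
      have "2 * N + 1 \<le> 3 ^ N" by (induction N) auto
      then have "real (2 * N + 1) \<le> real (3 ^ N)" by (rule of_nat_mono)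
      then show "real (card {i - int N..i + int N}) \<le> 3 ^ N" by (simp add: nat_add_distrib nat_mult_distrib)
    qed auto
    also have "\<dots> = (1 / 2) ^ N"
      by (simp flip: power_mult_distrib)
    finally show ?thesis .
  qed
  have "AE \<omega> in M. eventually (\<lambda>N. \<omega> \<in> space M - E i N) sequentially" for i
  proof (rule borel_cantelli_AE1)
    show "summable (\<lambda>N. prob (E i N))"
      by (rule summable_comparison_test'[OF summable_geometric[of "1 / 2 :: real"], of 0])
        (use E_le in auto)
  qed (use E in \<open>auto simp: less_top[symmetric]\<close>)
  then have "AE \<omega> in M. \<forall>i. eventually (\<lambda>N. \<omega> \<in> space M - E i N) sequentially"
    by (simp add: AE_all_countable)
  then show ?thesis
  proof (rule AE_mp, intro AE_I2 impI)
    fix \<omega> assume \<omega>: "\<omega> \<in> space M" "\<forall>i. eventually (\<lambda>N. \<omega> \<in> space M - E i N) sequentially"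
    define C where "C = {z. \<omega> \<in> closed z}"
    have "\<exists>N. \<forall>s n. (lip_step C)\<^sup>*\<^sup>* (s, 0) (i, n) \<longrightarrow> n \<le> N" for i
    proof -
      obtain N\<^sub>0 where N\<^sub>0: "\<And>N. N \<ge> N\<^sub>0 \<Longrightarrow> \<omega> \<notin> E i N"
        using \<omega>(2) unfolding eventually_sequentially by blast
      have "n \<le> int N\<^sub>0" if "(lip_step C)\<^sup>*\<^sup>* (s, 0) (i, n)" for s n
      proof (rule ccontr)
        assume n: "\<not> n \<le> int N\<^sub>0"
        \<comment> \<open>Removing loops keeps the end points. The final height is at most the
          number of steps, so the path has at least \<open>N\<^sub>0\<close> steps and realises an
          excluded event.\<close>
        obtain xs where xs: "rtrancl_path (lip_step C) (s, 0) xs (i, n)" "distinct xs"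
          using \<open>(lip_step C)\<^sup>*\<^sup>* (s, 0) (i, n)\<close> unfolding rtranclp_eq_rtrancl_path
          by (meson distinct.simps(2) rtrancl_path_distinct)
        note path = lip_path[OF xs(1), simplified]
        have "length (climbs (s, 0) xs) \<le> length xs"
          by (metis card_mono distinct_card distinct_climbs finite_set set_climbs_subset xs(2))
        then have "N\<^sub>0 \<le> length xs" using path(1) n by linarith
        moreover have "xs \<in> bad s (length xs)"
          using path(1,4) xs(2) n by (auto simp: bad_def)
        moreover have "\<omega> \<in> Q s xs" using path(3) \<omega>(1) by (auto simp: Q_def C_def)
        moreover have "s \<in> {i - int (length xs)..i + int (length xs)}" using path(2) by auto
        ultimately show False using N\<^sub>0[of "length xs"] unfolding E_def by blast
      qed
      then show ?thesis by blast
    qed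
    from lipschitz_function_if_heights_bounded[OF this]
    show "\<exists>\<beta> :: int \<Rightarrow> int. \<forall>i. 1 \<le> \<beta> i \<and> \<bar>\<beta> (i + 1) - \<beta> i\<bar> \<le> 1 \<and> \<omega> \<notin> closed (i, \<beta> i)"
      by (simp add: C_def)
  qed
qed

text \<open>Pigeonhole: one of the \<open>R\<^sup>2\<close> residue classes contains at least the average number of
  elements of \<open>S\<close>.\<close>

lemma (in prob_space) percolation_bound_of_sparse:
  fixes closed :: "int \<times> int \<Rightarrow> 'a set" and R :: nat
  assumes R: "0 < R" and events: "\<And>z. closed z \<in> events"
    and q: "0 \<le> q" "q \<le> r ^ (R * R)" and r: "0 \<le> r" "r \<le> 1"
    and sparse: "\<And>S. finite S \<Longrightarrow> (\<forall>z\<in>S. \<forall>w\<in>S. int R dvd fst z - fst w \<and> int R dvd snd z - snd w) \<Longrightarrow>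
      prob (space M \<inter> (\<Inter>z\<in>S. closed z)) \<le> q ^ card S"
    and S: "finite S"
  shows "prob (space M \<inter> (\<Inter>z\<in>S. closed z)) \<le> r ^ card S"
proof -
  define cls where "cls z = (fst z mod int R, snd z mod int R)" for z :: "int \<times> int"
  define K where "K = {0..<int R} \<times> {0..<int R}"
  define part where "part c = {z\<in>S. cls z = c}" for c
  have cls: "cls ` S \<subseteq> K" using R by (auto simp: cls_def K_def)
  have K: "finite K" "card K = R * R" by (auto simp: K_def card_cartesian_product)
  have part_fin: "finite (part c)" for c using S by (simp add: part_def)
  have "\<exists>c. card S \<le> R * R * card (part c)"
  proof (rule ccontr)
    assume "\<not> ?thesis"
    then have less: "R * R * card (part c) < card S" for c by (meson not_le)
    have "S = (\<Union>c\<in>K. part c)" using cls by (auto simp: part_def)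
    then have "card S \<le> (\<Sum>c\<in>K. card (part c))" using card_UN_le[OF K(1), of part] by simp
    then have "R * R * card S \<le> (\<Sum>c\<in>K. R * R * card (part c))" by (simp flip: sum_distrib_left)
    also have "\<dots> < (\<Sum>c\<in>K. card S)"
      using less K R by (intro sum_strict_mono) (auto simp: K_def)
    finally show False using K by simp
  qed
  then obtain c where c: "card S \<le> R * R * card (part c)" by blast
  have "prob (space M \<inter> (\<Inter>z\<in>S. closed z)) \<le> prob (space M \<inter> (\<Inter>z\<in>part c. closed z))"
  proof (rule finite_measure_mono)
    show "space M \<inter> (\<Inter>z\<in>part c. closed z) \<in> events"
    proof (cases "part c = {}")
      case False
      then show ?thesis using part_fin events by (intro sets.Int sets.finite_INT) auto
    qed simp
  qed (auto simp: part_def)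
  also have "\<dots> \<le> q ^ card (part c)"
  proof (intro sparse part_fin ballI)
    fix z w assume "z \<in> part c" "w \<in> part c"
    then show "int R dvd fst z - fst w \<and> int R dvd snd z - snd w"
      by (auto simp: part_def cls_def simp flip: mod_eq_dvd_iff)
  qed
  \<comment> \<open>The factor \<open>R * R\<close> lost in the exponent is regained from the
    assumption on \<open>q\<close>.\<close>
  also have "\<dots> \<le> (r ^ (R * R)) ^ card (part c)" using q by (intro power_mono)
  also have "\<dots> = r ^ (R * R * card (part c))" by (simp add: power_mult)
  also have "\<dots> \<le> r ^ card S" using c r by (intro power_decreasing)
  finally show ?thesis .
qed

section \<open>Discretisation of the plane\<close>

definition corner :: "real \<Rightarrow> real \<Rightarrow> real \<Rightarrow> int \<times> int \<Rightarrow> nat \<times> nat \<Rightarrow> real \<times> real" where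
  "corner d h \<epsilon> z c = (of_int (fst z) * d + real (fst c) * \<epsilon>, of_int (snd z) * h + real (snd c) * \<epsilon>)"

text \<open>Half-open, so that grid boxes and their cells tile without overlap.\<close>

definition rect :: "real \<times> real \<Rightarrow> real \<Rightarrow> real \<Rightarrow> (real \<times> real) set" where
  "rect p a b = {fst p..<fst p + a} \<times> {snd p..<snd p + b}"

text \<open>For \<open>m\<close> ranging over the integers, these rectangles cover a neighbourhood of the graph
  of the flank translated to \<open>p\<close>.\<close>

definition tube :: "real \<Rightarrow> real \<Rightarrow> real \<Rightarrow> real \<Rightarrow> real \<times> real \<Rightarrow> int \<Rightarrow> (real \<times> real) set" where
  "tube k d \<epsilon> r p m = rect (fst p + of_int m * \<epsilon>, snd p + flank k d (of_int m * \<epsilon>) - r) \<epsilon> (2 * r)"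

lemma rect_borel: "rect p a b \<in> sets borel"
  by (simp add: rect_def borel_Times)

lemma bounded_rect: "bounded (rect p a b)"
  unfolding rect_def by (intro bounded_Times) auto

lemma measure_rect:
  assumes "0 \<le> a" "0 \<le> b"
  shows "measure lborel (rect p a b) = a * b"
proof -
  have "emeasure lborel (rect p a b) = emeasure (lborel \<Otimes>\<^sub>M lborel) (rect p a b)"
    by (simp add: lborel_prod)
  also have "\<dots> = emeasure lborel {fst p..<fst p + a} * emeasure lborel {snd p..<snd p + b}"
    unfolding rect_def by (rule lborel.emeasure_pair_measure_Times) auto
  also have "\<dots> = ennreal (a * b)"
    using assms by (simp add: ennreal_mult)
  finally show ?thesis using assms by (simp add: measure_def)
qed

lemma interval_eq_UN_subintervals:
  fixes a \<epsilon> :: real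
  assumes "0 < \<epsilon>"
  shows "{a..<a + real N * \<epsilon>} = (\<Union>u\<in>{0..<N}. {a + real u * \<epsilon>..<a + real u * \<epsilon> + \<epsilon>})"
proof (intro equalityI subsetI)
  fix x assume x: "x \<in> {a..<a + real N * \<epsilon>}"
  define u where "u = nat \<lfloor>(x - a) / \<epsilon>\<rfloor>"
  have u: "real u \<le> (x - a) / \<epsilon>" "(x - a) / \<epsilon> < real u + 1"
    using x assms by (auto simp: u_def of_nat_nat)
  moreover have "(x - a) / \<epsilon> < real N" using x assms by (simp add: pos_divide_less_eq)
  ultimately have "u < N" by linarith
  with u assms show "x \<in> (\<Union>u\<in>{0..<N}. {a + real u * \<epsilon>..<a + real u * \<epsilon> + \<epsilon>})"
    by (intro UN_I[of u]) (auto simp: field_simps)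
next
  fix x assume "x \<in> (\<Union>u\<in>{0..<N}. {a + real u * \<epsilon>..<a + real u * \<epsilon> + \<epsilon>})"
  then obtain u where u: "u < N" "a + real u * \<epsilon> \<le> x" "x < a + real u * \<epsilon> + \<epsilon>" by auto
  have "(real u + 1) * \<epsilon> \<le> real N * \<epsilon>" using u(1) assms by (intro mult_right_mono) auto
  moreover have "0 \<le> real u * \<epsilon>" using assms by simp
  ultimately show "x \<in> {a..<a + real N * \<epsilon>}"
    using u(2,3) unfolding atLeastLessThan_iff distrib_right by linarith
qed

text \<open>Vertical errors: \<open>\<alpha> * \<epsilon>\<close> from \<open>p\<close>,
  \<open>\<epsilon>\<close> from the barrier, \<open>\<epsilon>\<close> from the position in the
  cell, and \<open>(\<alpha> + 2) * \<epsilon>\<close> from replacing \<open>x - a\<close> by a grid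
  point; one more \<open>\<epsilon>\<close> gives strictness. Horizontally, \<open>4 * d\<close>
  grows to \<open>5 * d\<close>, and to \<open>6 * d\<close> after rounding.\<close>

lemma near_flank_in_tube:
  assumes k: "0 \<le> k" "k \<le> 1" and d: "0 < \<epsilon>" "\<epsilon> \<le> d" "(\<alpha> + 1) * \<epsilon> \<le> d" "6 * d = of_int N * \<epsilon>"
    and ab: "(a, b) \<in> rect c \<epsilon> \<epsilon>" and x: "\<bar>x - a\<bar> \<le> 4 * d"
    and y: "\<bar>y - b - flank k d (x - a)\<bar> \<le> \<epsilon>" and p: "dist (x, y) p \<le> \<alpha> * \<epsilon>"
  shows "\<exists>m\<in>{- N..N}. p \<in> tube k d \<epsilon> ((2 * \<alpha> + 5) * \<epsilon>) c m"
proof -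
  obtain px py cx cy where eq: "p = (px, py)" "c = (cx, cy)" by (cases p, cases c)
  define m where "m = \<lfloor>(px - cx) / \<epsilon>\<rfloor>"
  have m: "of_int m * \<epsilon> \<le> px - cx" "px - cx < of_int m * \<epsilon> + \<epsilon>"
    using d floor_divide_lower[of \<epsilon> "px - cx"] floor_divide_upper[of \<epsilon> "px - cx"]
    by (auto simp: m_def distrib_right)
  have px: "\<bar>x - px\<bar> \<le> \<alpha> * \<epsilon>" and py: "\<bar>y - py\<bar> \<le> \<alpha> * \<epsilon>"
    using p dist_fst_le[of "(x, y)" p] dist_snd_le[of "(x, y)" p]
    by (auto simp: eq dist_real_def)
  have a: "cx \<le> a" "a < cx + \<epsilon>" and b: "cy \<le> b" "b < cy + \<epsilon>"
    using ab by (auto simp: rect_def eq)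
  have "(\<alpha> + 1) * \<epsilon> = \<alpha> * \<epsilon> + \<epsilon>" by (simp add: distrib_right)
  then have "\<bar>px - cx\<bar> \<le> 5 * d"
    using px a x d(3) by linarith
  then have m_abs: "\<bar>of_int m * \<epsilon>\<bar> \<le> 6 * d" using m d(1,2) by linarith
  then have "\<bar>of_int m\<bar> * \<epsilon> \<le> of_int N * \<epsilon>" using d by (simp add: abs_mult)
  then have "\<bar>of_int m\<bar> \<le> (of_int N :: real)" using d(1) by simp
  then have "m \<in> {- N..N}" by (simp add: abs_le_iff)
  have "\<bar>flank k d (x - a) - flank k d (of_int m * \<epsilon>)\<bar> \<le> \<bar>(x - a) - of_int m * \<epsilon>\<bar>"
    using k d x m_abs by (intro flank_lipschitz) auto
  moreover have "\<bar>(x - a) - of_int m * \<epsilon>\<bar> \<le> \<alpha> * \<epsilon> + 2 * \<epsilon>"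
    using m px a by linarith
  moreover have "(2 * \<alpha> + 5) * \<epsilon> = 2 * (\<alpha> * \<epsilon>) + 5 * \<epsilon>" by (simp add: algebra_simps)
  ultimately have "p \<in> tube k d \<epsilon> ((2 * \<alpha> + 5) * \<epsilon>) c m"
    unfolding tube_def rect_def eq mem_Times_iff atLeastLessThan_iff fst_conv snd_conv
    using y py b m d(1) by linarith
  with \<open>m \<in> {- N..N}\<close> show ?thesis by blast
qed

lemma tube_subset:
  assumes k: "0 \<le> k" "k \<le> 1" and \<epsilon>: "0 < \<epsilon>" "\<epsilon> \<le> d" and r: "r \<le> h"
    and m: "m \<in> {- N..N}" "6 * d = of_int N * \<epsilon>"
    and c: "real (fst c) * \<epsilon> \<le> d" "real (snd c) * \<epsilon> \<le> h"
  shows "tube k d \<epsilon> r (corner d h \<epsilon> z c) m \<subseteq>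
    {(of_int (fst z) - 6) * d..<(of_int (fst z) + 8) * d} \<times> {(of_int (snd z) - 1) * h..(of_int (snd z) + 2) * h + 3 * d}"
proof -
  have "\<bar>of_int m\<bar> \<le> (of_int N :: real)" using m(1) by auto
  then have "\<bar>of_int m\<bar> * \<epsilon> \<le> of_int N * \<epsilon>" using \<epsilon> by (intro mult_right_mono) auto
  then have m_abs: "\<bar>of_int m * \<epsilon>\<bar> \<le> 6 * d" using \<epsilon> m(2) by (simp add: abs_mult)
  have "k / 2 * \<bar>of_int m * \<epsilon>\<bar> \<le> 1 / 2 * (6 * d)" using k m_abs by (intro mult_mono) auto
  then have flank: "flank k d (of_int m * \<epsilon>) \<le> 3 * d"
    using flank_le[of k d "of_int m * \<epsilon>"] k \<epsilon> by linarith
  have "0 \<le> flank k d (of_int m * \<epsilon>)" using k \<epsilon> m_abs by (intro flank_nonneg) auto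
  moreover have "0 \<le> real (fst c) * \<epsilon>" "0 \<le> real (snd c) * \<epsilon>" using \<epsilon> by auto
  ultimately have "x \<in> {(of_int (fst z) - 6) * d..<(of_int (fst z) + 8) * d} \<and>
      y \<in> {(of_int (snd z) - 1) * h..(of_int (snd z) + 2) * h + 3 * d}"
    if "(x, y) \<in> tube k d \<epsilon> r (corner d h \<epsilon> z c) m" for x y
    using that m_abs flank c r \<epsilon>
    unfolding tube_def rect_def corner_def mem_Times_iff fst_conv snd_conv atLeastLessThan_iff
      atLeastAtMost_iff left_diff_distrib distrib_right by linarith
  then show ?thesis by auto
qed

text \<open>By \<open>d = real L * h\<close> a tube stays in a rectangle of 14 columns and
  \<open>3 * L + 3\<close> rows; distinct sites congruent modulo \<open>3 * L + 20\<close> are too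
  far apart for these to meet.\<close>

lemma disjoint_tubes:
  assumes k: "0 \<le> k" "k \<le> 1" and \<epsilon>: "0 < \<epsilon>" "\<epsilon> \<le> d" and r: "r \<le> h" and h: "0 < h" "d = real L * h"
    and m: "m \<in> {- N..N}" "m' \<in> {- N..N}" "6 * d = of_int N * \<epsilon>"
    and c: "real (fst c) * \<epsilon> \<le> d" "real (snd c) * \<epsilon> \<le> h" "real (fst c') * \<epsilon> \<le> d" "real (snd c') * \<epsilon> \<le> h"
    and zw: "z \<noteq> w" "int (3 * L + 20) dvd fst z - fst w" "int (3 * L + 20) dvd snd z - snd w"
  shows "tube k d \<epsilon> r (corner d h \<epsilon> z c) m \<inter> tube k d \<epsilon> r (corner d h \<epsilon> w c') m' = {}"
proof (rule ccontr)
  assume "\<not> ?thesis"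
  then obtain x y where
    "(x, y) \<in> tube k d \<epsilon> r (corner d h \<epsilon> z c) m" "(x, y) \<in> tube k d \<epsilon> r (corner d h \<epsilon> w c') m'" by auto
  then have x: "(of_int (fst z) - 6) * d \<le> x" "x < (of_int (fst z) + 8) * d"
      "(of_int (fst w) - 6) * d \<le> x" "x < (of_int (fst w) + 8) * d"
    and y: "(of_int (snd z) - 1) * h \<le> y" "y \<le> (of_int (snd z) + 2) * h + 3 * d"
      "(of_int (snd w) - 1) * h \<le> y" "y \<le> (of_int (snd w) + 2) * h + 3 * d"
    using tube_subset[OF k \<epsilon> r m(1,3) c(1,2), of z] tube_subset[OF k \<epsilon> r m(2,3) c(3,4), of w]
    by auto
  have "0 < d" using \<epsilon> by simp
  have lt: "of_int (fst z) - 6 < (of_int (fst w) + 8 :: real)" "of_int (fst w) - 6 < (of_int (fst z) + 8 :: real)"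
    using mult_less_cancel_right_pos[OF \<open>0 < d\<close>] x le_less_trans by blast+
  have y2: "(of_int (snd z) + 2) * h + 3 * d = (of_int (snd z) + 2 + 3 * real L) * h"
    "(of_int (snd w) + 2) * h + 3 * d = (of_int (snd w) + 2 + 3 * real L) * h"
    by (simp_all add: h(2) algebra_simps)
  have le: "of_int (snd z) - 1 \<le> (of_int (snd w) + 2 + 3 * real L)" "of_int (snd w) - 1 \<le> (of_int (snd z) + 2 + 3 * real L)"
    using mult_le_cancel_right_pos[OF h(1)] y[unfolded y2] order_trans by blast+
  have "\<bar>fst z - fst w\<bar> < int (3 * L + 20)" "\<bar>snd z - snd w\<bar> < int (3 * L + 20)"
    using lt le by linarith+
  then have "fst z = fst w" "snd z = snd w"
    using zw(2,3) dvd_imp_le_int[of "fst z - fst w" "int (3 * L + 20)"]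
      dvd_imp_le_int[of "snd z - snd w" "int (3 * L + 20)"] by linarith+
  with zw(1) show False by (simp add: prod_eq_iff)
qed

lemma disjoint_grid_boxes:
  fixes d h :: real
  assumes "0 < d" "0 < h" "z \<noteq> w"
  shows "rect (of_int (fst z) * d, of_int (snd z) * h) d h \<inter> rect (of_int (fst w) * d, of_int (snd w) * h) d h = {}"
proof -
  have "i = j" if "of_int i * s \<le> x" "x < of_int i * s + s" "of_int j * s \<le> x" "x < of_int j * s + s" "0 < s"
    for i j :: int and x s :: real
  proof -
    have "of_int i * s < of_int (j + 1) * s" "of_int j * s < of_int (i + 1) * s"
      using that by (auto simp: distrib_right)
    then have "i < j + 1" "j < i + 1"
      using \<open>0 < s\<close> by (simp_all only: mult_less_cancel_right_pos of_int_less_iff)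
    then show ?thesis by simp
  qed
  then show ?thesis
    using assms by (auto simp: rect_def prod_eq_iff)
qed

lemma int_lipschitz_of_unit_steps:
  fixes \<beta> :: "int \<Rightarrow> int"
  assumes "\<And>i. \<bar>\<beta> (i + 1) - \<beta> i\<bar> \<le> 1"
  shows "\<bar>\<beta> i - \<beta> j\<bar> \<le> \<bar>i - j\<bar>"
proof -
  have step: "\<bar>\<beta> (i + int n) - \<beta> i\<bar> \<le> int n" for i n
  proof (induction n)
    case (Suc n)
    have "\<beta> (i + int (Suc n)) = \<beta> (i + int n + 1)" by (simp add: algebra_simps)
    then show ?case using Suc assms[of "i + int n"] by linarith
  qed simp
  show ?thesis
  proof (cases "j \<le> i")
    case True
    then show ?thesis using step[of j "nat (i - j)"] by simp
  next
    case False
    then show ?thesis using step[of i "nat (j - i)"] by (simp add: abs_minus_commute)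
  qed
qed

theorem theorem3p3:
  fixes M :: "'w measure"
    and lp lm \<alpha> k :: real
    and Xp Xm :: "nat \<Rightarrow> 'w \<Rightarrow> real \<times> real"
    and \<phi> :: "real \<times> real \<Rightarrow> real"
  assumes "prob_space M"
    and "lp > 0" and "lm > 0"
    and "poisson_point_process M lp Xp"
    and "poisson_point_process M lm Xm"
    and "independent_point_processes M Xp Xm"
    and "\<alpha> > sqrt 2"
    and "smooth_compact_support \<phi>"
    and "\<And>p. \<phi> p \<ge> 0"
    and "\<And>p. p \<in> {-1..1} \<times> {-1..1} \<Longrightarrow> \<phi> p \<ge> 1"
    and "\<And>p. p \<notin> ball 0 \<alpha> \<Longrightarrow> \<phi> p = 0"
    and "0 < k" and "k \<le> 1"
  shows "\<exists>\<rho> > 0. \<exists>F > 0. AE \<omega> in M. \<exists>v :: real \<Rightarrow> real.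
           (\<forall>x. v x > 0) \<and>
           viscosity_supersolution (obstacle_force k \<phi> Xp \<rho> \<omega>) F v \<and>
           (\<forall>x j. dist (x, v x) (Xm j \<omega>) > \<alpha> * \<rho>)"
proof -
  interpret prob_space M by fact
  note Xp = assms(4) and Xm = assms(5)
  have \<alpha>: "0 < \<alpha>" using assms(7) real_sqrt_ge_zero[of 2] by linarith

  \<comment> \<open>With \<open>d = real L * h\<close> this gives
    \<open>20 * h < k * d\<close>.\<close>
  obtain L :: nat where "20 / k < real L" using reals_Archimedean2 by blast
  then have L: "20 < k * real L" "0 < L"
    using assms(12) by (auto simp: pos_divide_less_eq mult.commute intro!: Nat.gr0I)
  \<comment> \<open>Tubes of distinct sites congruent modulo \<open>R\<close> are disjoint. In
    \<open>q\<close>, the exponent \<open>R * R\<close> pays for the pigeonhole step and the square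
    for the factor 2 in the percolation bound.\<close>
  define R where "R = 3 * L + 20"
  define q :: real where "q = ((1 / 18)\<^sup>2) ^ (R * R)"
  have q: "0 < q" by (simp add: q_def)
  \<comment> \<open>Chosen to make an empty box have probability at most \<open>q / 2\<close>;
    \<open>h \<ge> 1\<close> allows passing from \<open>h\<close> to \<open>h * h\<close>.\<close>
  define h where "h = max 1 (ln (2 / q) / (lp * real L))"
  define d where "d = real L * h"
  have h: "1 \<le> h" "0 < h" by (auto simp: h_def)
  have d: "0 < d" "h \<le> d" using L h by (auto simp: d_def)
  define C where "C = 2 * \<alpha> + 5"
  have C: "5 \<le> C" using \<alpha> by (simp add: C_def)
  \<comment> \<open>\<open>K / n\<close> will bound the total over all pairs of a cell and a tube
    piece: there are of order \<open>n ^ 3\<close> pairs, each of probability of order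
    \<open>1 / n ^ 4\<close>.\<close>
  define K where "K = 26 * C * (real L)\<^sup>2 * lp * lm * h ^ 4"
  obtain n :: nat where n: "max C (2 * K / q) < real n" using reals_Archimedean2 by blast
  \<comment> \<open>Both the cell width and the obstacle radius \<open>\<rho>\<close>. The choice
    \<open>n > C\<close> keeps the half-height \<open>C * \<epsilon>\<close> of a tube below
    \<open>h\<close>.\<close>
  define \<epsilon> where "\<epsilon> = h / real n"
  have "0 < n" using n C by (cases n) auto
  have \<epsilon>: "0 < \<epsilon>" "real n * \<epsilon> = h" "real (L * n) * \<epsilon> = d"
    using h \<open>0 < n\<close> by (auto simp: \<epsilon>_def d_def)
  have "C * \<epsilon> \<le> real n * \<epsilon>" using n \<epsilon>(1) by (intro mult_right_mono) auto
  then have r: "C * \<epsilon> \<le> h" using \<epsilon>(2) by simp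
  have "(\<alpha> + 1) * \<epsilon> \<le> C * \<epsilon>" "1 * \<epsilon> \<le> C * \<epsilon>"
    using \<alpha> \<epsilon>(1) by (intro mult_right_mono; simp add: C_def)+
  then have small: "(\<alpha> + 1) * \<epsilon> \<le> d" "\<epsilon> \<le> d" using r d(2) by linarith+
  define N where "N = int (6 * L * n)"
  have N: "6 * d = of_int N * \<epsilon>" using \<epsilon>(3) by (simp add: N_def algebra_simps)
  define I where "I = {0..<L * n} \<times> {0..<n}"
  define J where "J = {- N..N}"
  define box where "box z = rect (of_int (fst z) * d, of_int (snd z) * h) d h" for z :: "int \<times> int"
  define cell where "cell z c = rect (corner d h \<epsilon> z c) \<epsilon> \<epsilon>" for z c
  define T where "T z c m = tube k d \<epsilon> (C * \<epsilon>) (corner d h \<epsilon> z c) m" for z c m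
  \<comment> \<open>Rounding obstacle positions to cells reduces the condition to finitely many
    fixed regions; the tubes are thick enough to absorb the rounding.\<close>
  define closed where "closed z = {\<omega> \<in> space M. \<forall>c\<in>I. hits Xp (cell z c) \<omega> \<longrightarrow> (\<exists>m\<in>J. hits Xm (T z c m) \<omega>)}" for z

  have borel: "box z \<in> sets borel" "cell z c \<in> sets borel" "T z c m \<in> sets borel" for z c m
    by (auto simp: box_def cell_def T_def tube_def rect_borel)
  have fin: "finite I" "finite J" by (auto simp: I_def J_def)
  have box_eq: "box z = (\<Union>c\<in>I. cell z c)" for z
  proof -
    have "box z = (\<Union>u\<in>{0..<L * n}. {of_int (fst z) * d + real u * \<epsilon>..<of_int (fst z) * d + real u * \<epsilon> + \<epsilon>}) \<times>
        (\<Union>v\<in>{0..<n}. {of_int (snd z) * h + real v * \<epsilon>..<of_int (snd z) * h + real v * \<epsilon> + \<epsilon>})"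
      unfolding interval_eq_UN_subintervals[OF \<epsilon>(1), symmetric] \<epsilon>(2,3) box_def rect_def by simp
    then show ?thesis by (simp only:) (auto simp: cell_def rect_def corner_def I_def)
  qed
  have closed_event: "closed z \<in> events" for z
    unfolding closed_def using fin
    by (intro sets.sets_Collect_finite_All sets.sets_Collect_imp sets.sets_Collect_finite_Ex
        hits_event[OF Xp] hits_event[OF Xm] borel)

  have q_bound: "exp (- (lp * (d * h))) + real (card I * card J) * ((lp * (\<epsilon> * \<epsilon>)) * (lm * (\<epsilon> * (2 * (C * \<epsilon>))))) \<le> q"
  proof -
    have "ln (2 / q) / (lp * real L) \<le> h" by (simp add: h_def)
    then have "ln (2 / q) \<le> lp * real L * h"
      using assms(2) L by (subst (asm) pos_divide_le_eq) (auto simp: mult_ac)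
    also have "\<dots> \<le> lp * real L * h * h"
      using assms(2) h mult_left_mono[of 1 h "lp * real L * h"] by simp
    also have "\<dots> = lp * (d * h)" by (simp add: d_def)
    finally have "exp (- (lp * (d * h))) \<le> exp (- ln (2 / q))" by simp
    also have "\<dots> = q / 2" using q by (simp add: exp_minus)
    finally have 1: "exp (- (lp * (d * h))) \<le> q / 2" .
    \<comment> \<open>Bounding \<open>12 * L * n + 1\<close> by \<open>13 * L * n\<close> and using
      tube height \<open>2 * C * \<epsilon>\<close> gives the 26 in \<open>K\<close>.\<close>
    have "card J = 12 * L * n + 1" by (simp add: J_def N_def nat_add_distrib nat_mult_distrib)
    then have "card I * card J \<le> (L * n * n) * (13 * L * n)"
      using L(2) \<open>0 < n\<close> by (simp add: I_def)
    then have "real (card I * card J) \<le> real ((L * n * n) * (13 * L * n))" by (rule of_nat_mono)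
    then have "real (card I * card J) * ((lp * (\<epsilon> * \<epsilon>)) * (lm * (\<epsilon> * (2 * (C * \<epsilon>)))))
        \<le> real ((L * n * n) * (13 * L * n)) * ((lp * (\<epsilon> * \<epsilon>)) * (lm * (\<epsilon> * (2 * (C * \<epsilon>)))))"
      using assms(2,3) \<epsilon>(1) C by (intro mult_right_mono) auto
    also have "\<dots> = K / real n"
      using \<open>0 < n\<close> by (simp add: K_def \<epsilon>_def field_simps power2_eq_square power4_eq_xxxx)
    also have "\<dots> \<le> q / 2"
      using n q \<open>0 < n\<close> by (simp add: field_simps)
    finally show ?thesis using 1 by simp
  qed

  have sparse: "prob (space M \<inter> (\<Inter>z\<in>S. closed z)) \<le> q ^ card S"
    if S: "finite S" "\<forall>z\<in>S. \<forall>w\<in>S. int R dvd fst z - fst w \<and> int R dvd snd z - snd w" for S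
  proof -
    have eq: "space M \<inter> (\<Inter>z\<in>S. closed z) =
        {\<omega> \<in> space M. \<forall>z\<in>S. \<forall>c\<in>I. hits Xp (cell z c) \<omega> \<longrightarrow> (\<exists>m\<in>J. hits Xm (T z c m) \<omega>)}"
      by (auto simp: closed_def)
    have "prob (space M \<inter> (\<Inter>z\<in>S. closed z)) \<le>
        (exp (- (lp * (d * h))) + real (card I * card J) * ((lp * (\<epsilon> * \<epsilon>)) * (lm * (\<epsilon> * (2 * (C * \<epsilon>)))))) ^ card S"
      unfolding eq
    proof (rule prob_all_blocked_le[OF Xp Xm assms(6) _ _ S(1) fin borel])
      show "bounded (box z)" "bounded (cell z c)" "bounded (T z c m)" for z c m
        by (auto simp: box_def cell_def T_def tube_def bounded_rect)
      show "box z \<subseteq> (\<Union>c\<in>I. cell z c)" for z by (simp add: box_eq)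
      show "cell z c \<subseteq> box z" if "c \<in> I" for z c using that by (auto simp: box_eq)
      show "disjoint_family_on box S"
        unfolding disjoint_family_on_def box_def using disjoint_grid_boxes[OF d(1) h(2)] by blast
      show "measure lborel (box z) = d * h" "measure lborel (cell z c) = \<epsilon> * \<epsilon>"
        "measure lborel (T z c m) = \<epsilon> * (2 * (C * \<epsilon>))" for z c m
        using d h \<epsilon>(1) C by (simp_all add: box_def cell_def T_def tube_def measure_rect)
      fix z w c c' m m'
      assume zw: "z \<in> S" "w \<in> S" "z \<noteq> w" and c: "c \<in> I" "c' \<in> I" and m: "m \<in> J" "m' \<in> J"
      have c_le: "real (fst c) * \<epsilon> \<le> d" "real (snd c) * \<epsilon> \<le> h" if "c \<in> I" for c
        unfolding \<epsilon>(2,3)[symmetric] using that \<epsilon>(1)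
        by (intro mult_right_mono of_nat_mono; auto simp: I_def)+
      show "T z c m \<inter> T w c' m' = {}"
        unfolding T_def using assms(12,13) zw S(2) m
        by (intro disjoint_tubes[OF _ _ \<epsilon>(1) small(2) r h(2) d_def _ _ N c_le(1)[OF c(1)] c_le(2)[OF c(1)]
              c_le(1)[OF c(2)] c_le(2)[OF c(2)]]) (auto simp: J_def R_def)
    qed (use assms(2,3) in auto)
    also have "\<dots> \<le> q ^ card S"
      using q_bound assms(2,3) \<epsilon>(1) C by (intro power_mono add_nonneg_nonneg mult_nonneg_nonneg) auto
    finally show ?thesis .
  qed
  have "prob (space M \<inter> (\<Inter>z\<in>S. closed z)) \<le> (1 / 18) ^ (2 * card S)" if "finite S" for S
    \<comment> \<open>The bound is read as a power of \<open>(1 / 18)\<^sup>2\<close>, the rate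
      whose power \<open>R * R\<close> is \<open>q\<close>.\<close>
    unfolding power_mult
    using q by (intro percolation_bound_of_sparse[where R = R and q = q, OF _ closed_event _ _ _ _ sparse that])
      (auto simp: q_def R_def power2_eq_square)
  with closed_event have "AE \<omega> in M. \<exists>\<beta> :: int \<Rightarrow> int.
      \<forall>i. 1 \<le> \<beta> i \<and> \<bar>\<beta> (i + 1) - \<beta> i\<bar> \<le> 1 \<and> \<omega> \<notin> closed (i, \<beta> i)"
    by (rule lipschitz_percolation)
  from this AE_finite_points[OF Xp] AE_space
  have "AE \<omega> in M. \<exists>v :: real \<Rightarrow> real. (\<forall>x. v x > 0) \<and>
      viscosity_supersolution (obstacle_force k \<phi> Xp \<epsilon> \<omega>) (k / (50 * d)) v \<and>
      (\<forall>x j. dist (x, v x) (Xm j \<omega>) > \<alpha> * \<epsilon>)"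
  proof eventually_elim
    case (elim \<omega>)
    then obtain \<beta> :: "int \<Rightarrow> int" where \<beta>: "\<And>i. 1 \<le> \<beta> i" "\<And>i. \<bar>\<beta> (i + 1) - \<beta> i\<bar> \<le> 1" "\<And>i. \<omega> \<notin> closed (i, \<beta> i)"
      by blast
    have "\<exists>c j. c \<in> I \<and> Xp j \<omega> \<in> cell (i, \<beta> i) c \<and> (\<forall>m\<in>J. \<not> hits Xm (T (i, \<beta> i) c m) \<omega>)" for i
      using \<beta>(3)[of i] elim(3) unfolding closed_def hits_def[of Xp] by blast
    then obtain c j where cj: "\<And>i. c i \<in> I" "\<And>i. Xp (j i) \<omega> \<in> cell (i, \<beta> i) (c i)"
      "\<And>i m. m \<in> J \<Longrightarrow> \<not> hits Xm (T (i, \<beta> i) (c i) m) \<omega>"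
      by metis
    define a where "a i = fst (Xp (j i) \<omega>)" for i
    define b where "b i = snd (Xp (j i) \<omega>)" for i
    have ab_box: "(a i, b i) \<in> box (i, \<beta> i)" for i
      using cj(1,2) unfolding box_eq a_def b_def by auto
    have a: "of_int i * d \<le> a i" "a i < (of_int i + 1) * d"
      and b: "of_int (\<beta> i) * h \<le> b i" "b i < of_int (\<beta> i) * h + h" for i
      using ab_box[of i] by (auto simp: box_def rect_def distrib_right)
    have b_pos: "0 < b i" for i
    proof -
      have "1 * h \<le> of_int (\<beta> i) * h" using \<beta>(1)[of i] h by (intro mult_right_mono) auto
      then show ?thesis using b(1)[of i] h by linarith
    qed
    \<comment> \<open>Four box heights come from the surface and at most one from the positions
      inside the boxes.\<close>
    have b_lip: "\<bar>b i - b i'\<bar> \<le> 5 * h" if "\<bar>i - i'\<bar> \<le> 4" for i i'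
    proof -
      have "\<bar>\<beta> i - \<beta> i'\<bar> \<le> 4" using int_lipschitz_of_unit_steps[of \<beta>, OF \<beta>(2), of i i'] that by linarith
      then have "of_int \<bar>\<beta> i - \<beta> i'\<bar> \<le> (4 :: real)" by linarith
      then have "of_int \<bar>\<beta> i - \<beta> i'\<bar> * h \<le> 4 * h" using h by (intro mult_right_mono) auto
      then have "\<bar>of_int (\<beta> i) * h - of_int (\<beta> i') * h\<bar> \<le> 4 * h"
        using h by (simp flip: left_diff_distrib add: abs_mult)
      then show ?thesis using b[of i] b[of i'] by linarith
    qed
    have "20 * h < k * d" using L(1) h(2) by (simp add: d_def mult.assoc[symmetric])
    moreover note locally_finite = elim(2)[rule_format]
    ultimately have "\<exists>v. (\<forall>x. 0 < v x) \<and> viscosity_supersolution (obstacle_force k \<phi> Xp \<epsilon> \<omega>) (k / (50 * d)) v \<and>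
        (\<forall>x. \<exists>i. \<bar>x - a i\<bar> \<le> 4 * d \<and> \<bar>v x - b i - flank k d (x - a i)\<bar> \<le> \<epsilon>)"
      using assms(9-13) d \<epsilon>(1) small(2) a b_pos b_lip
      by (intro exists_supersolution_through_points)
        (auto simp: a_def b_def intro!: obstacle_force_nonneg[where \<alpha> = \<alpha>] obstacle_force_ge[where \<alpha> = \<alpha>])
    then obtain v where v: "\<And>x. 0 < v x" "viscosity_supersolution (obstacle_force k \<phi> Xp \<epsilon> \<omega>) (k / (50 * d)) v"
      "\<And>x. \<exists>i. \<bar>x - a i\<bar> \<le> 4 * d \<and> \<bar>v x - b i - flank k d (x - a i)\<bar> \<le> \<epsilon>"
      by blast
    \<comment> \<open>A negative point this close would lie in a tube piece of the selected cell,
      and these pieces contain none.\<close>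
    have "\<alpha> * \<epsilon> < dist (x, v x) (Xm l \<omega>)" for x l
    proof (rule ccontr)
      assume "\<not> ?thesis"
      moreover obtain i where "\<bar>x - a i\<bar> \<le> 4 * d" "\<bar>v x - b i - flank k d (x - a i)\<bar> \<le> \<epsilon>"
        using v(3) by blast
      moreover have "(a i, b i) \<in> rect (corner d h \<epsilon> (i, \<beta> i) (c i)) \<epsilon> \<epsilon>"
        using cj(2)[of i] by (simp add: cell_def a_def b_def)
      ultimately have "\<exists>m\<in>{- N..N}. Xm l \<omega> \<in> tube k d \<epsilon> ((2 * \<alpha> + 5) * \<epsilon>) (corner d h \<epsilon> (i, \<beta> i) (c i)) m"
        using assms(12,13) by (intro near_flank_in_tube[OF _ _ \<epsilon>(1) small(2,1) N]) auto
      then show False using cj(3)[of _ i] by (auto simp: J_def T_def C_def hits_def)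
    qed
    with v(1,2) show ?case by blast
  qed
  then show ?thesis
    using \<epsilon>(1) assms(12) d(1) by (intro exI[of _ \<epsilon>] conjI exI[of _ "k / (50 * d)"]) auto
qed

end
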